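(* Let $(\rho,u)$ be a solution to the Boussinesq system on $\Omega=\mathbb T\times(0,1)$ with initial data $(\rho_0,u_0)$, let $v$ be the associated steady Stokes field, and $w:=u-v$. There exist constants $C_1,C_2>0$, depending only on $\|\rho_0\|_{L^4}$ and $E_T(0)$, such that \[ \frac{d}{dt}\bigl(C_1E_T(t)+S(t)\bigr)\le -C_2\left(\|\nabla u\|_{L^2}^2+\|\nabla w\|_{L^2}^2+\|\nabla v\|_{L^2}^2\right). \]
   Context: $\Omega:=\mathbb{T}\times(0,1)$, with $\mathbb T=\mathbb R/2\pi\mathbb Z$ and $x=(x_1,x_2)$. The Boussinesq system (gravity and viscosity constants equal to $1$) is \[ \rho_t+u\cdot\nabla\rho=0,\qquad u_t+u\cdot\nabla u=-\nabla p-\begin{pmatrix}0\\ \rho\end{pmatrix}+\Delta u,\qquad \nabla\cdot u=0,\qquad t\ge 0,\ x\in\Omega, \] with $u=0$ on $\partial\Omega$ and $(\rho,u)|_{t=0}=(\rho_0,u_0)$; solutions are understood to be classical (sufficiently regular for the stated quantities to make sense). For each $t$, $v=v(t)$ is the unique solution of the steady Stokes problem \[ -\Delta v=-\nabla q-\begin{pmatrix}0\\ \rho(t)\end{pmatrix},\quad \nabla\cdot v=0\ \text{ in }\Omega,\qquad v=0\ \text{ on }\partial\Omega . \] Energies: $E_P(t):=\int_\Omega(\rho(t)-\rho_0^* )x_2\,dx$, $E_K(t):=\frac12\int_\Omega|u(t)|^2dx$, $E_T(t):=E_P(t)+E_K(t)$, and $S(t):=\frac12\int_\Omega|w(t)|^2dx$.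 Vertical rearrangement: for $\rho\ge0$, $\rho^*(x):=\int_0^\infty 1_{\{0\le x_2\le |\{\rho>s\}|/|\mathbb T|\}}ds$; for bounded $\rho$ of general sign, $\rho^*:=(\rho+c)^*-c$ for any constant $c$ with $\rho+c\ge 0$. Thus $\rho^*$ is the non-increasing function of $x_2$ equimeasurable with $\rho$. *)

theory Defs
  imports "HOL-Analysis.Analysis"
begin

text \<open>
  A function on \<open>\<Omega> = \<T> \<times> (0,1)\<close> with \<open>\<T> = \<real> / 2\<pi>\<int>\<close> is represented by its lift to
  \<open>\<real> \<times> (0,1)\<close>, which is \<open>2\<pi>\<close>-periodic in the first variable.  \<open>Omega\<close> and
  \<open>Omega_bar\<close> are the lifts of the domain and of its closure; \<open>cell\<close> is a fundamental
  domain of \<open>\<Omega>\<close>, over which all integrals are taken.  Values of a field outside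
  \<open>Omega_bar\<close>, or at negative times, are irrelevant.
\<close>

definition Omega :: "(real \<times> real) set" where
  "Omega = UNIV \<times> {0<..<1}"

definition Omega_bar :: "(real \<times> real) set" where
  "Omega_bar = UNIV \<times> {0..1}"

definition cell :: "(real \<times> real) set" where
  "cell = {0..<2 * pi} \<times> {0<..<1}"

definition x1_periodic :: "(real \<times> real \<Rightarrow> 'a) \<Rightarrow> bool" where
  "x1_periodic f \<longleftrightarrow> (\<forall>x\<in>Omega_bar. f (fst x + 2 * pi, snd x) = f x)"

definition L_norm :: "real \<Rightarrow> (real \<times> real \<Rightarrow> 'a::real_normed_vector) \<Rightarrow> real" where
  "L_norm r f = (LINT x:cell|lborel. norm (f x) powr r) powr (1 / r)"


text \<open>
  Partial derivatives.  They are one-sided at \<open>x\<^sub>2 = 0\<close>, \<open>x\<^sub>2 = 1\<close> and at \<open>t = 0\<close>,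
  so that they describe functions which are differentiable up to the boundary.
\<close>

definition D1 :: "(real \<times> real \<Rightarrow> 'a::real_normed_vector) \<Rightarrow> real \<times> real \<Rightarrow> 'a" where
  "D1 f x = vector_derivative (\<lambda>s. f (s, snd x)) (at (fst x))"

definition D2 :: "(real \<times> real \<Rightarrow> 'a::real_normed_vector) \<Rightarrow> real \<times> real \<Rightarrow> 'a" where
  "D2 f x = vector_derivative (\<lambda>s. f (fst x, s)) (at (snd x) within {0..1})"

definition Dt :: "(real \<Rightarrow> real \<times> real \<Rightarrow> 'a::real_normed_vector) \<Rightarrow> real \<Rightarrow> real \<times> real \<Rightarrow> 'a" where
  "Dt f t x = vector_derivative (\<lambda>s. f s x) (at t within {0..})"

text \<open>
  For a vector field, the norm of \<open>grad u x\<close> in the product space is the Frobenius norm of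
  the Jacobian of \<open>u\<close> at \<open>x\<close>.
\<close>

definition grad :: "(real \<times> real \<Rightarrow> 'a::real_normed_vector) \<Rightarrow> real \<times> real \<Rightarrow> 'a \<times> 'a" where
  "grad f x = (D1 f x, D2 f x)"

definition divergence :: "(real \<times> real \<Rightarrow> real \<times> real) \<Rightarrow> real \<times> real \<Rightarrow> real" where
  "divergence u x = fst (D1 u x) + snd (D2 u x)"

definition laplacian :: "(real \<times> real \<Rightarrow> 'a::real_normed_vector) \<Rightarrow> real \<times> real \<Rightarrow> 'a" where
  "laplacian f x = D1 (D1 f) x + D2 (D2 f) x"

definition advect ::
  "(real \<times> real \<Rightarrow> real \<times> real) \<Rightarrow> (real \<times> real \<Rightarrow> 'a::real_normed_vector) \<Rightarrow> real \<times> real \<Rightarrow> 'a"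
where
  "advect u f x = fst (u x) *\<^sub>R D1 f x + snd (u x) *\<^sub>R D2 f x"


text \<open>Classical regularity: all derivatives in question are continuous up to the boundary.\<close>

definition C1_bar :: "(real \<times> real \<Rightarrow> 'a::real_normed_vector) \<Rightarrow> bool" where
  "C1_bar f \<longleftrightarrow> x1_periodic f
    \<and> (\<forall>x\<in>Omega_bar. (\<lambda>s. f (s, snd x)) differentiable (at (fst x))
        \<and> (\<lambda>s. f (fst x, s)) differentiable (at (snd x) within {0..1}))
    \<and> continuous_on Omega_bar f
    \<and> continuous_on Omega_bar (D1 f) \<and> continuous_on Omega_bar (D2 f)"

definition C2_bar :: "(real \<times> real \<Rightarrow> 'a::real_normed_vector) \<Rightarrow> bool" where
  "C2_bar f \<longleftrightarrow> C1_bar f \<and> C1_bar (D1 f) \<and> C1_bar (D2 f)"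

definition jointly_continuous ::
  "(real \<Rightarrow> real \<times> real \<Rightarrow> 'a::real_normed_vector) \<Rightarrow> bool"
where
  "jointly_continuous f \<longleftrightarrow> continuous_on ({0..} \<times> Omega_bar) (\<lambda>(t, x). f t x)"

definition C1_time :: "(real \<Rightarrow> real \<times> real \<Rightarrow> 'a::real_normed_vector) \<Rightarrow> bool" where
  "C1_time f \<longleftrightarrow> jointly_continuous f \<and> jointly_continuous (Dt f)
    \<and> (\<forall>t\<ge>0. \<forall>x\<in>Omega_bar. (\<lambda>s. f s x) differentiable (at t within {0..}))"

definition C1_space :: "(real \<Rightarrow> real \<times> real \<Rightarrow> 'a::real_normed_vector) \<Rightarrow> bool" where
  "C1_space f \<longleftrightarrow> (\<forall>t\<ge>0. C1_bar (f t))
    \<and> jointly_continuous f \<and> jointly_continuous (\<lambda>t. D1 (f t))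
    \<and> jointly_continuous (\<lambda>t. D2 (f t))"

definition C2_space :: "(real \<Rightarrow> real \<times> real \<Rightarrow> 'a::real_normed_vector) \<Rightarrow> bool" where
  "C2_space f \<longleftrightarrow>
    C1_space f \<and> C1_space (\<lambda>t. D1 (f t)) \<and> C1_space (\<lambda>t. D2 (f t))"


text \<open>
  The pressure carries no regularity in time, since it is only determined up to an additive
  function of \<open>t\<close>.
\<close>

definition boussinesq_solution ::
  "(real \<times> real \<Rightarrow> real) \<Rightarrow> (real \<times> real \<Rightarrow> real \<times> real) \<Rightarrow>
   (real \<Rightarrow> real \<times> real \<Rightarrow> real) \<Rightarrow> (real \<Rightarrow> real \<times> real \<Rightarrow> real \<times> real) \<Rightarrow> bool"
where
  "boussinesq_solution \<rho>\<^sub>0 u\<^sub>0 \<rho> u \<longleftrightarrow>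
     C1_time \<rho> \<and> C1_space \<rho> \<and> C1_time u \<and> C2_space u
   \<and> (\<forall>x\<in>Omega_bar. \<rho> 0 x = \<rho>\<^sub>0 x \<and> u 0 x = u\<^sub>0 x)
   \<and> (\<forall>t\<ge>0. \<forall>x\<in>Omega_bar - Omega. u t x = 0)
   \<and> (\<forall>t\<ge>0. \<forall>x\<in>Omega. Dt \<rho> t x + advect (u t) (\<rho> t) x = 0)
   \<and> (\<forall>t\<ge>0. \<forall>x\<in>Omega. divergence (u t) x = 0)
   \<and> (\<exists>p. (\<forall>t\<ge>0. C1_bar (p t))
        \<and> (\<forall>t\<ge>0. \<forall>x\<in>Omega. Dt u t x + advect (u t) (u t) x
             = - grad (p t) x - (0, \<rho> t x) + laplacian (u t) x))"

definition stokes_solution ::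
  "(real \<times> real \<Rightarrow> real) \<Rightarrow> (real \<times> real \<Rightarrow> real \<times> real) \<Rightarrow> bool"
where
  "stokes_solution r v \<longleftrightarrow> C2_bar v
   \<and> (\<forall>x\<in>Omega_bar - Omega. v x = 0)
   \<and> (\<forall>x\<in>Omega. divergence v x = 0)
   \<and> (\<exists>q. C1_bar q \<and> (\<forall>x\<in>Omega. - laplacian v x = - grad q x - (0, r x)))"


definition rearr_nonneg :: "(real \<times> real \<Rightarrow> real) \<Rightarrow> real \<times> real \<Rightarrow> real" where
  "rearr_nonneg r x = (LINT s:{0..}|lborel.
     indicator {s. 0 \<le> snd x \<and> snd x \<le> measure lborel {y\<in>cell. r y > s} / (2 * pi)} s)"

text \<open>For bounded measurable \<open>r\<close> the value on \<open>Omega\<close> does not depend on the choice of the shift \<open>c\<close>.\<close>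

definition rearr :: "(real \<times> real \<Rightarrow> real) \<Rightarrow> real \<times> real \<Rightarrow> real" where
  "rearr r x = (let c = (SOME c. \<forall>y\<in>Omega. 0 \<le> r y + c)
     in rearr_nonneg (\<lambda>y. r y + c) x - c)"

definition potential_energy :: "(real \<times> real \<Rightarrow> real) \<Rightarrow> (real \<times> real \<Rightarrow> real) \<Rightarrow> real" where
  "potential_energy \<rho>\<^sub>0 r = (LINT x:cell|lborel. (r x - rearr \<rho>\<^sub>0 x) * snd x)"

definition kinetic_energy :: "(real \<times> real \<Rightarrow> real \<times> real) \<Rightarrow> real" where
  "kinetic_energy u = 1 / 2 * (LINT x:cell|lborel. (norm (u x))\<^sup>2)"

definition total_energy ::
  "(real \<times> real \<Rightarrow> real) \<Rightarrow> (real \<times> real \<Rightarrow> real) \<Rightarrow> (real \<times> real \<Rightarrow> real \<times> real) \<Rightarrow> real"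
where
  "total_energy \<rho>\<^sub>0 r u = potential_energy \<rho>\<^sub>0 r + kinetic_energy u"

end

theory Submission
  imports Defs
begin

text \<open>
  Potential and kinetic energy exchange through the
  buoyancy work \<open>\<integral>\<rho> u\<^sub>2\<close>, so \<open>E\<^sub>T' = - \<parallel>\<nabla>u\<parallel>\<^sub>2\<^sup>2\<close> exactly (\<open>total_energy_derivative\<close>). The deviation
  \<open>w = u - v\<close> satisfies \<open>w\<^sub>t = \<Delta>w - \<nabla>\<pi> - (u \<cdot> \<nabla>) u - v\<^sub>t\<close> for some \<open>\<pi>\<close>, because the Stokes equation
  for \<open>v\<close> cancels the buoyancy; hence
  \<open>S' = - \<parallel>\<nabla>w\<parallel>\<^sub>2\<^sup>2 - \<integral>w \<cdot> (u \<cdot> \<nabla>) u - \<integral>w \<cdot> v\<^sub>t\<close> (\<open>deviation_energy_derivative\<close>).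

  It remains to bound the two error terms by a multiple of \<open>M \<parallel>\<nabla>u\<parallel>\<^sub>2 \<parallel>\<nabla>w\<parallel>\<^sub>2\<close> with
  \<open>M = \<parallel>\<rho>\<^sub>0\<parallel>\<^sub>4\<close>, which equals \<open>\<parallel>\<rho>(t)\<parallel>\<^sub>4\<close> since \<open>\<rho>\<close> is transported by a solenoidal field
  (\<open>density_L_norm_4\<close>). They can then be absorbed by Young's inequality, as \<open>E\<^sub>T\<close> enters with a large
  factor (\<open>young_absorption\<close>).

  For the convective term, skew-symmetry of transport gives
  \<open>\<integral>w \<cdot> (u \<cdot> \<nabla>) u = \<integral>w \<cdot> (u \<cdot> \<nabla>) v = - \<integral>v \<cdot> (u \<cdot> \<nabla>) w\<close>. Hoelder's inequality, the embedding
  \<open>\<parallel>f\<parallel>\<^sub>4 \<le> 3 \<parallel>\<nabla>f\<parallel>\<^sub>2\<close> for fields that vanish on the walls (\<open>L_norm_4_le_grad\<close>) and the Stokes estimate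
  \<open>\<parallel>\<nabla>v\<parallel>\<^sub>2 \<le> 4 M\<close> (\<open>stokes_gradient_bound\<close>) give the claim.

  For the other term, \<open>v\<^sub>t\<close> solves the Stokes problem with forcing \<open>\<rho>\<^sub>t = - \<nabla> \<cdot> (\<rho> u)\<close>. Testing with \<open>v\<^sub>t\<close>
  and moving the derivative away from \<open>\<rho> u\<close> yields \<open>\<parallel>\<nabla>v\<^sub>t\<parallel>\<^sub>2 \<le> \<parallel>\<rho> u\<parallel>\<^sub>2 \<le> M \<parallel>u\<parallel>\<^sub>4\<close>
  (\<open>weak_stokes_bound\<close>). As \<open>v\<close> is only given time by time, this argument is carried out for difference
  quotients, whose convergence follows from that of the difference quotients of \<open>\<rho>\<close>
  (\<open>stokes_velocity_weakly_differentiable\<close>).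
\<close>

section \<open>Integration over the cell\<close>

text \<open>
  Integrals over the half-open cell are computed as Henstock-Kurzweil integrals over the compact
  cell, where continuous functions are integrable and the fundamental theorem of calculus applies.
\<close>

definition closed_cell :: "(real \<times> real) set" where
  "closed_cell = cbox (0, 0) (2 * pi, 1)"

abbreviation cell_int :: "(real \<times> real \<Rightarrow> real) \<Rightarrow> real" where
  "cell_int f \<equiv> integral closed_cell f"

lemma closed_cell_eq: "closed_cell = {0..2*pi} \<times> {0..1}"
  by (simp add: closed_cell_def cbox_Pair_eq)

lemma closed_cell_subset: "closed_cell \<subseteq> Omega_bar"
  by (auto simp: closed_cell_eq Omega_bar_def)

lemma compact_closed_cell: "compact closed_cell"
  by (simp add: closed_cell_def)

lemma cell_integrable:
  fixes f :: "real \<times> real \<Rightarrow> real"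
  assumes "continuous_on Omega_bar f"
  shows "f integrable_on closed_cell"
  using continuous_on_subset[OF assms closed_cell_subset]
  by (simp add: closed_cell_def integrable_continuous)

lemma cell_subset_closed_cell: "cell \<subseteq> closed_cell"
  by (auto simp: cell_def closed_cell_eq)

lemma cell_sets [measurable]: "cell \<in> sets borel"
  unfolding cell_def by (intro borel_Times) auto

lemma closed_cell_diff_null: "closed_cell - cell \<in> null_sets lborel"
proof (rule null_sets_subset)
  show "cbox (0, 0) (2 * pi, 1::real) - box (0, 0) (2 * pi, 1) \<in> null_sets lborel"
    by (rule null_sets_cbox_Diff_box)
  show "closed_cell - cell \<subseteq> cbox (0, 0) (2 * pi, 1) - box (0, 0) (2 * pi, 1)"
    by (auto simp: closed_cell_def cell_def mem_box Basis_prod_def)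
  show "closed_cell - cell \<in> sets lborel"
    by (simp add: closed_cell_def)
qed

lemma
  fixes f :: "real \<times> real \<Rightarrow> real"
  assumes "continuous_on Omega_bar f"
  shows set_integrable_cell: "set_integrable lborel cell f"
    and set_integral_cell: "(LINT x:cell|lborel. f x) = cell_int f"
proof -
  have K: "set_integrable lborel closed_cell f"
    unfolding set_integrable_def
    by (intro borel_integrable_compact compact_closed_cell continuous_on_subset[OF assms closed_cell_subset])
  show C: "set_integrable lborel cell f"
    using K by (rule set_integrable_subset) (auto simp: cell_subset_closed_cell)
  have "(LINT x:cell|lborel. f x) = (LINT x:closed_cell|lborel. f x)"
  proof (rule set_integral_cong_set)
    show "set_borel_measurable lborel closed_cell f" "set_borel_measurable lborel cell f"
      using K C by (auto simp: set_integrable_def set_borel_measurable_def)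
    show "AE x in lborel. (x \<in> closed_cell) = (x \<in> cell)"
      using AE_not_in[OF closed_cell_diff_null] cell_subset_closed_cell by (auto elim!: eventually_mono)
  qed
  also have "\<dots> = cell_int f"
    using K by (rule set_borel_integral_eq_integral)
  finally show "(LINT x:cell|lborel. f x) = cell_int f" .
qed

section \<open>Calculus of fields that are differentiable up to the boundary\<close>

lemma C1_bar_D1:
  assumes "C1_bar f" "x \<in> Omega_bar"
  shows "((\<lambda>s. f (s, snd x)) has_vector_derivative D1 f x) (at (fst x))"
  using assms by (simp add: C1_bar_def D1_def vector_derivative_works)

lemma C1_bar_D2:
  assumes "C1_bar f" "x \<in> Omega_bar"
  shows "((\<lambda>s. f (fst x, s)) has_vector_derivative D2 f x) (at (snd x) within {0..1})"
  using assms by (simp add: C1_bar_def D2_def vector_derivative_works)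

lemma C1_bar_continuous:
  assumes "C1_bar f"
  shows "continuous_on Omega_bar f" "continuous_on Omega_bar (D1 f)" "continuous_on Omega_bar (D2 f)"
  using assms by (auto simp: C1_bar_def)

lemma C1_bar_periodic: "C1_bar f \<Longrightarrow> x1_periodic f"
  by (simp add: C1_bar_def)

lemma D1_eqI:
  assumes "((\<lambda>s. f (s, snd x)) has_vector_derivative d) (at (fst x))"
  shows "D1 f x = d"
  using assms by (simp add: D1_def vector_derivative_at)

lemma D2_eqI:
  assumes "((\<lambda>s. f (fst x, s)) has_vector_derivative d) (at (snd x) within {0..1})"
    and "x \<in> Omega_bar"
  shows "D2 f x = d"
  using vector_derivative_within_cbox[of 0 1 "snd x" "\<lambda>s. f (fst x, s)" d] assms
  by (auto simp: D2_def Omega_bar_def)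

text \<open>
  To see that a field built from \<open>C1_bar\<close> fields is again \<open>C1_bar\<close>, it suffices to exhibit its
  derivatives; they are then the values of \<^term>\<open>D1\<close> and \<^term>\<open>D2\<close>.
\<close>

lemma C1_barI:
  assumes "x1_periodic f" "continuous_on Omega_bar f"
    and 1: "\<And>x. x \<in> Omega_bar \<Longrightarrow> ((\<lambda>s. f (s, snd x)) has_vector_derivative f1 x) (at (fst x))"
    and 2: "\<And>x. x \<in> Omega_bar \<Longrightarrow>
      ((\<lambda>s. f (fst x, s)) has_vector_derivative f2 x) (at (snd x) within {0..1})"
    and "continuous_on Omega_bar f1" "continuous_on Omega_bar f2"
  shows "C1_bar f" "\<And>x. x \<in> Omega_bar \<Longrightarrow> D1 f x = f1 x" "\<And>x. x \<in> Omega_bar \<Longrightarrow> D2 f x = f2 x"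
proof -
  show d1: "D1 f x = f1 x" if "x \<in> Omega_bar" for x
    using 1[OF that] by (rule D1_eqI)
  show d2: "D2 f x = f2 x" if "x \<in> Omega_bar" for x
    using 2[OF that] that by (rule D2_eqI)
  have "continuous_on Omega_bar (D1 f)" "continuous_on Omega_bar (D2 f)"
    using assms(5,6) by (simp_all cong: continuous_on_cong add: d1 d2)
  then show "C1_bar f"
    using assms(1,2) differentiableI_vector[OF 1] differentiableI_vector[OF 2]
    by (auto simp: C1_bar_def)
qed

lemma
  assumes "bounded_bilinear pr" and f: "C1_bar f" and g: "C1_bar g"
  shows C1_bar_bilinear: "C1_bar (\<lambda>x. pr (f x) (g x))"
    and D1_bilinear: "\<And>x. x \<in> Omega_bar \<Longrightarrow>
      D1 (\<lambda>x. pr (f x) (g x)) x = pr (f x) (D1 g x) + pr (D1 f x) (g x)"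
    and D2_bilinear: "\<And>x. x \<in> Omega_bar \<Longrightarrow>
      D2 (\<lambda>x. pr (f x) (g x)) x = pr (f x) (D2 g x) + pr (D2 f x) (g x)"
proof -
  interpret bounded_bilinear pr by fact
  note c = C1_bar_continuous[OF f] C1_bar_continuous[OF g]
  have "x1_periodic (\<lambda>x. pr (f x) (g x))"
    using C1_bar_periodic[OF f] C1_bar_periodic[OF g] by (simp add: x1_periodic_def)
  note * = C1_barI[OF this, where ?f1.0 = "\<lambda>x. pr (f x) (D1 g x) + pr (D1 f x) (g x)"
      and ?f2.0 = "\<lambda>x. pr (f x) (D2 g x) + pr (D2 f x) (g x)"]
  have 1: "((\<lambda>s. pr (f (s, snd x)) (g (s, snd x))) has_vector_derivative
      pr (f x) (D1 g x) + pr (D1 f x) (g x)) (at (fst x))" if "x \<in> Omega_bar" for x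
    using has_vector_derivative[OF C1_bar_D1[OF f that] C1_bar_D1[OF g that]] by simp
  have 2: "((\<lambda>s. pr (f (fst x, s)) (g (fst x, s))) has_vector_derivative
      pr (f x) (D2 g x) + pr (D2 f x) (g x)) (at (snd x) within {0..1})" if "x \<in> Omega_bar" for x
    using has_vector_derivative[OF C1_bar_D2[OF f that] C1_bar_D2[OF g that]] by simp
  have "continuous_on Omega_bar (\<lambda>x. pr (f x) (g x))"
    "continuous_on Omega_bar (\<lambda>x. pr (f x) (D1 g x) + pr (D1 f x) (g x))"
    "continuous_on Omega_bar (\<lambda>x. pr (f x) (D2 g x) + pr (D2 f x) (g x))"
    by (intro continuous_intros continuous_on c)+
  note * = *[OF this(1) 1 2 this(2,3)]
  show "C1_bar (\<lambda>x. pr (f x) (g x))"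
    "\<And>x. x \<in> Omega_bar \<Longrightarrow>
      D1 (\<lambda>x. pr (f x) (g x)) x = pr (f x) (D1 g x) + pr (D1 f x) (g x)"
    "\<And>x. x \<in> Omega_bar \<Longrightarrow>
      D2 (\<lambda>x. pr (f x) (g x)) x = pr (f x) (D2 g x) + pr (D2 f x) (g x)"
    using * by blast+
qed

lemma
  assumes "bounded_linear h" and f: "C1_bar f"
  shows C1_bar_linear: "C1_bar (\<lambda>x. h (f x))"
    and D1_linear: "\<And>x. x \<in> Omega_bar \<Longrightarrow> D1 (\<lambda>x. h (f x)) x = h (D1 f x)"
    and D2_linear: "\<And>x. x \<in> Omega_bar \<Longrightarrow> D2 (\<lambda>x. h (f x)) x = h (D2 f x)"
proof -
  interpret bounded_linear h by fact
  note c = C1_bar_continuous[OF f]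
  have "x1_periodic (\<lambda>x. h (f x))"
    using C1_bar_periodic[OF f] by (simp add: x1_periodic_def)
  note * = C1_barI[OF this, where ?f1.0 = "\<lambda>x. h (D1 f x)" and ?f2.0 = "\<lambda>x. h (D2 f x)"]
  have "continuous_on Omega_bar (\<lambda>x. h (f x))"
    "continuous_on Omega_bar (\<lambda>x. h (D1 f x))" "continuous_on Omega_bar (\<lambda>x. h (D2 f x))"
    by (intro continuous_on c)+
  note * = *[OF this(1) has_vector_derivative[OF C1_bar_D1[OF f]]
    has_vector_derivative[OF C1_bar_D2[OF f]] this(2,3)]
  show "C1_bar (\<lambda>x. h (f x))"
    "\<And>x. x \<in> Omega_bar \<Longrightarrow> D1 (\<lambda>x. h (f x)) x = h (D1 f x)"
    "\<And>x. x \<in> Omega_bar \<Longrightarrow> D2 (\<lambda>x. h (f x)) x = h (D2 f x)"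
    using * by blast+
qed

lemma
  assumes f: "C1_bar f" and g: "C1_bar g"
  shows C1_bar_diff: "C1_bar (\<lambda>x. f x - g x)"
    and D1_diff: "\<And>x. x \<in> Omega_bar \<Longrightarrow> D1 (\<lambda>x. f x - g x) x = D1 f x - D1 g x"
    and D2_diff: "\<And>x. x \<in> Omega_bar \<Longrightarrow> D2 (\<lambda>x. f x - g x) x = D2 f x - D2 g x"
proof -
  note c = C1_bar_continuous[OF f] C1_bar_continuous[OF g]
  have "x1_periodic (\<lambda>x. f x - g x)"
    using C1_bar_periodic[OF f] C1_bar_periodic[OF g] by (simp add: x1_periodic_def)
  note * = C1_barI[OF this, where ?f1.0 = "\<lambda>x. D1 f x - D1 g x" and ?f2.0 = "\<lambda>x. D2 f x - D2 g x"]
  have "continuous_on Omega_bar (\<lambda>x. f x - g x)"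
    "continuous_on Omega_bar (\<lambda>x. D1 f x - D1 g x)" "continuous_on Omega_bar (\<lambda>x. D2 f x - D2 g x)"
    by (intro continuous_intros c)+
  note * = *[OF this(1) has_vector_derivative_diff[OF C1_bar_D1[OF f] C1_bar_D1[OF g]]
    has_vector_derivative_diff[OF C1_bar_D2[OF f] C1_bar_D2[OF g]] this(2,3)]
  show "C1_bar (\<lambda>x. f x - g x)"
    "\<And>x. x \<in> Omega_bar \<Longrightarrow> D1 (\<lambda>x. f x - g x) x = D1 f x - D1 g x"
    "\<And>x. x \<in> Omega_bar \<Longrightarrow> D2 (\<lambda>x. f x - g x) x = D2 f x - D2 g x"
    using * by blast+
qed

lemma C1_bar_snd: "C1_bar (\<lambda>x. snd x)" and D1_snd: "\<And>x. x \<in> Omega_bar \<Longrightarrow> D1 snd x = (0::real)"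
  and D2_snd: "\<And>x. x \<in> Omega_bar \<Longrightarrow> D2 snd x = (1::real)"
  using C1_barI[of "\<lambda>x::real\<times>real. snd x" "\<lambda>_. 0" "\<lambda>_. 1"]
  by (auto simp: x1_periodic_def has_vector_derivative_const continuous_intros has_vector_derivative_id)

lemma grad_linear:
  assumes "bounded_linear h" "C1_bar f" "x \<in> Omega_bar"
  shows "grad (\<lambda>x. h (f x)) x = (h (D1 f x), h (D2 f x))"
  using assms by (simp add: grad_def D1_linear D2_linear)

text \<open>
  The differential equations hold in the open strip only. All their terms are continuous up to the
  boundary, so they extend to the closed strip, over which the integrals are taken.
\<close>

lemma eq_on_Omega_bar:
  fixes f g :: "real \<times> real \<Rightarrow> 'a::real_normed_vector"
  assumes "continuous_on Omega_bar f" "continuous_on Omega_bar g"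
    and "\<And>x. x \<in> Omega \<Longrightarrow> f x = g x" and "x \<in> Omega_bar"
  shows "f x = g x"
proof -
  have "closure Omega = Omega_bar"
    by (simp add: Omega_def Omega_bar_def closure_Times)
  then show ?thesis
    using continuous_constant_on_closure[of Omega "\<lambda>x. f x - g x" 0 x] assms
    by (auto intro: continuous_on_diff)
qed

section \<open>Integrals of derivatives over the cell\<close>

lemma cell_int_fubini:
  assumes "continuous_on Omega_bar f"
  shows "cell_int f = integral {0..2*pi} (\<lambda>a. integral {0..1} (\<lambda>b. f (a, b)))" (is ?A)
    and "cell_int f = integral {0..1} (\<lambda>b. integral {0..2*pi} (\<lambda>a. f (a, b)))" (is ?B)
proof -
  have c: "continuous_on (cbox (0, 0) (2 * pi, 1)) f"
    using continuous_on_subset[OF assms closed_cell_subset] by (simp add: closed_cell_def)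
  show ?A
    using integral_prod_continuous[OF c] by (simp add: closed_cell_def)
  also have "\<dots> = integral {0..1} (\<lambda>b. integral {0..2*pi} (\<lambda>a. f (a, b)))"
    using integral_swap_continuous[of 0 0 "2*pi" 1 "\<lambda>a b. f (a, b)"] c by simp
  finally show ?B .
qed

text \<open>
  Periodicity makes the boundary values at \<open>x\<^sub>1 = 0\<close> and \<open>x\<^sub>1 = 2\<pi>\<close> cancel.
\<close>

lemma cell_int_D1:
  fixes f :: "real \<times> real \<Rightarrow> real"
  assumes "C1_bar f"
  shows "cell_int (D1 f) = 0"
proof -
  have "integral {0..2*pi} (\<lambda>a. D1 f (a, b)) = 0" if "b \<in> {0..1}" for b
  proof -
    have "((\<lambda>a. D1 f (a, b)) has_integral f (2*pi, b) - f (0, b)) {0..2*pi}"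
      using C1_bar_D1[OF assms, of "(_, b)"] that
      by (intro fundamental_theorem_of_calculus)
         (auto simp: Omega_bar_def intro: has_vector_derivative_at_within)
    moreover have "f (2*pi, b) = f (0, b)"
      using bspec[OF C1_bar_periodic[OF assms, unfolded x1_periodic_def], of "(0, b)"] that
      by (simp add: Omega_bar_def)
    ultimately show ?thesis by (simp add: integral_unique)
  qed
  then show ?thesis
    using cell_int_fubini(2)[OF C1_bar_continuous(2)[OF assms]]
    by (metis (no_types, lifting) integral_cong integral_0)
qed

lemma cell_int_D2:
  fixes f :: "real \<times> real \<Rightarrow> real"
  assumes "C1_bar f" and bdry: "\<And>x. x \<in> Omega_bar - Omega \<Longrightarrow> f x = 0"
  shows "cell_int (D2 f) = 0"
proof -
  have "integral {0..1} (\<lambda>b. D2 f (a, b)) = 0" for a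
  proof -
    have "((\<lambda>b. D2 f (a, b)) has_integral f (a, 1) - f (a, 0)) {0..1}"
      using C1_bar_D2[OF assms(1), of "(a, _)"]
      by (intro fundamental_theorem_of_calculus) (auto simp: Omega_bar_def)
    then show ?thesis
      using bdry[of "(a,0)"] bdry[of "(a,1)"] by (simp add: integral_unique Omega_bar_def Omega_def)
  qed
  then show ?thesis
    using cell_int_fubini(1)[OF C1_bar_continuous(3)[OF assms(1)]] by simp
qed

section \<open>Hoelder inequalities\<close>

lemma L_norm_nonneg: "0 \<le> L_norm r f"
  by (simp add: L_norm_def)

lemma powr_inverse_numeral_power: "(x powr (1 / numeral n)) ^ numeral n = x" if "0 \<le> x" for x :: real
proof -
  have "(x powr (1 / numeral n)) ^ numeral n = (x powr (1 / numeral n)) powr numeral n"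
    by (rule powr_numeral[symmetric]) simp
  also have "\<dots> = x"
    using that by (simp add: powr_powr)
  finally show ?thesis .
qed

lemma
  fixes f :: "real \<times> real \<Rightarrow> 'a::real_normed_vector"
  assumes "continuous_on Omega_bar f"
  shows L_norm_2: "(L_norm 2 f)\<^sup>2 = cell_int (\<lambda>x. (norm (f x))\<^sup>2)"
    and L_norm_4: "L_norm 4 f ^ 4 = cell_int (\<lambda>x. norm (f x) ^ 4)"
proof -
  have nn: "0 \<le> cell_int (\<lambda>x. norm (f x) ^ n)" for n
    by (rule integral_nonneg) (auto intro!: cell_integrable continuous_intros assms)
  have "(LINT x:cell|lborel. norm (f x) ^ n) = cell_int (\<lambda>x. norm (f x) ^ n)" for n
    by (rule set_integral_cell) (intro continuous_intros assms)
  then show "(L_norm 2 f)\<^sup>2 = cell_int (\<lambda>x. (norm (f x))\<^sup>2)"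
    and "L_norm 4 f ^ 4 = cell_int (\<lambda>x. norm (f x) ^ 4)"
    using nn[of 2] nn[of 4] by (simp_all add: L_norm_def powr_numeral powr_inverse_numeral_power)
qed

lemma cell_int_nonneg:
  assumes "continuous_on Omega_bar f" "\<And>x. x \<in> closed_cell \<Longrightarrow> 0 \<le> f x"
  shows "0 \<le> cell_int f"
  using assms by (intro integral_nonneg cell_integrable)

lemma cell_int_mono:
  assumes "continuous_on Omega_bar f" "continuous_on Omega_bar g"
    and "\<And>x. x \<in> closed_cell \<Longrightarrow> f x \<le> g x"
  shows "cell_int f \<le> cell_int g"
  using assms by (intro integral_le cell_integrable)

lemma cell_int_add:
  assumes "continuous_on Omega_bar f" "continuous_on Omega_bar g"
  shows "cell_int (\<lambda>x. f x + g x) = cell_int f + cell_int g"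
  using assms by (intro integral_add cell_integrable)

lemma cell_int_diff:
  assumes "continuous_on Omega_bar f" "continuous_on Omega_bar g"
  shows "cell_int (\<lambda>x. f x - g x) = cell_int f - cell_int g"
  using assms by (intro integral_diff cell_integrable)

lemma cell_int_cong:
  assumes "\<And>x. x \<in> Omega_bar \<Longrightarrow> f x = g x"
  shows "cell_int f = cell_int g"
  using assms closed_cell_subset by (intro integral_cong) blast

lemma cell_int_abs_le:
  assumes "continuous_on Omega_bar f" "continuous_on Omega_bar g"
    and "\<And>x. x \<in> closed_cell \<Longrightarrow> \<bar>f x\<bar> \<le> g x"
  shows "\<bar>cell_int f\<bar> \<le> cell_int g"
  using integral_norm_bound_integral[of f closed_cell g] assms by (simp add: cell_integrable)

lemma L_norm_2_le:
  fixes f :: "real \<times> real \<Rightarrow> 'a::real_normed_vector" and g :: "real \<times> real \<Rightarrow> 'b::real_normed_vector"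
  assumes "continuous_on Omega_bar f" "continuous_on Omega_bar g"
    and "\<And>x. x \<in> closed_cell \<Longrightarrow> norm (f x) \<le> norm (g x)"
  shows "L_norm 2 f \<le> L_norm 2 g"
proof (rule power2_le_imp_le)
  show "(L_norm 2 f)\<^sup>2 \<le> (L_norm 2 g)\<^sup>2"
    unfolding L_norm_2[OF assms(1)] L_norm_2[OF assms(2)] using assms
    by (intro cell_int_mono continuous_intros power_mono) auto
qed (rule L_norm_nonneg)

text \<open>
  The integral of \<open>(s|f| - r|g|)\<^sup>2\<close> is a nonnegative quadratic form in \<open>(s, r)\<close>; taking
  \<open>s = \<parallel>g\<parallel>\<^sub>2\<close> and \<open>r = \<parallel>f\<parallel>\<^sub>2\<close> gives the inequality when both norms are positive.
\<close>

lemma cell_int_Cauchy_Schwarz: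
  fixes f :: "real \<times> real \<Rightarrow> 'a::real_normed_vector" and g :: "real \<times> real \<Rightarrow> 'b::real_normed_vector"
  assumes f: "continuous_on Omega_bar f" and g: "continuous_on Omega_bar g"
  shows "cell_int (\<lambda>x. norm (f x) * norm (g x)) \<le> L_norm 2 f * L_norm 2 g"
proof -
  define a where "a = L_norm 2 f"
  define b where "b = L_norm 2 g"
  define p where "p = cell_int (\<lambda>x. norm (f x) * norm (g x))"
  have a: "a\<^sup>2 = cell_int (\<lambda>x. (norm (f x))\<^sup>2)" "0 \<le> a"
    and b: "b\<^sup>2 = cell_int (\<lambda>x. (norm (g x))\<^sup>2)" "0 \<le> b"
    by (simp_all add: a_def b_def L_norm_2 f g L_norm_nonneg)
  have quad: "0 \<le> s\<^sup>2 * a\<^sup>2 - 2 * s * r * p + r\<^sup>2 * b\<^sup>2" for s r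
  proof -
    have "0 \<le> cell_int (\<lambda>x. (s * norm (f x) - r * norm (g x))\<^sup>2)"
      by (intro cell_int_nonneg continuous_intros f g) auto
    also have "\<dots> = cell_int (\<lambda>x. s\<^sup>2 * (norm (f x))\<^sup>2 - 2 * s * r * (norm (f x) * norm (g x))
        + r\<^sup>2 * (norm (g x))\<^sup>2)"
      by (simp add: power2_eq_square algebra_simps)
    also have "\<dots> = s\<^sup>2 * a\<^sup>2 - 2 * s * r * p + r\<^sup>2 * b\<^sup>2"
      unfolding a b p_def
      by (subst cell_int_add cell_int_diff, (intro continuous_intros f g)+)+ simp
    finally show ?thesis .
  qed
  have "p \<le> a * b"
  proof (cases "a = 0 \<or> b = 0")
    case True
    \<comment> \<open>If one norm vanishes, the form is affine in one variable, and a large value of that variable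
      makes it negative unless the mixed term is nonpositive.\<close>
    show ?thesis
    proof (rule ccontr)
      assume "\<not> p \<le> a * b"
      then have p: "p > 0" using a b by (smt (verit) mult_nonneg_nonneg)
      from True show False
      proof
        assume "a = 0"
        then show False using quad[of "(b\<^sup>2 + 1) / p" 1] p zero_le_power2[of b] by simp
      next
        assume "b = 0"
        then show False using quad[of 1 "(a\<^sup>2 + 1) / p"] p zero_le_power2[of a] by simp
      qed
    qed
  next
    case False
    then have ab: "a * b > 0" using a(2) b(2) by simp
    have "0 \<le> 2 * (a * b) * (a * b - p)"
      using quad[of b a] by (simp add: algebra_simps power2_eq_square)
    then show ?thesis using ab by (simp add: zero_le_mult_iff)
  qed
  then show ?thesis by (simp add: p_def a_def b_def)
qed

lemma L_norm_2_diff_le: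
  fixes f g :: "real \<times> real \<Rightarrow> 'a::real_normed_vector"
  assumes f: "continuous_on Omega_bar f" and g: "continuous_on Omega_bar g"
  shows "L_norm 2 (\<lambda>x. f x - g x) \<le> L_norm 2 f + L_norm 2 g"
proof (rule power2_le_imp_le)
  have "(L_norm 2 (\<lambda>x. f x - g x))\<^sup>2 \<le>
      cell_int (\<lambda>x. (norm (f x))\<^sup>2 + (norm (g x))\<^sup>2 + 2 * (norm (f x) * norm (g x)))"
  proof (subst L_norm_2)
    have "(norm (f x - g x))\<^sup>2 \<le> (norm (f x))\<^sup>2 + (norm (g x))\<^sup>2 + 2 * (norm (f x) * norm (g x))" for x
      using power_mono[OF norm_triangle_ineq4[of "f x" "g x"], of 2] by (simp add: power2_sum)
    then show "cell_int (\<lambda>x. (norm (f x - g x))\<^sup>2) \<le>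
      cell_int (\<lambda>x. (norm (f x))\<^sup>2 + (norm (g x))\<^sup>2 + 2 * (norm (f x) * norm (g x)))"
      by (intro cell_int_mono continuous_intros f g)
  qed (intro continuous_intros f g)
  also have "\<dots> = (L_norm 2 f)\<^sup>2 + (L_norm 2 g)\<^sup>2 + 2 * cell_int (\<lambda>x. norm (f x) * norm (g x))"
    unfolding L_norm_2[OF f] L_norm_2[OF g]
    by (subst cell_int_add, (intro continuous_intros f g)+)+ simp
  also have "\<dots> \<le> (L_norm 2 f + L_norm 2 g)\<^sup>2"
    using cell_int_Cauchy_Schwarz[OF f g] by (simp add: power2_sum)
  finally show "(L_norm 2 (\<lambda>x. f x - g x))\<^sup>2 \<le> (L_norm 2 f + L_norm 2 g)\<^sup>2" .
qed (simp add: L_norm_nonneg)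

lemma L_norm_4_sq:
  fixes f :: "real \<times> real \<Rightarrow> 'a::real_normed_vector"
  assumes f: "continuous_on Omega_bar f"
  shows "L_norm 2 (\<lambda>x. (norm (f x))\<^sup>2) = (L_norm 4 f)\<^sup>2"
proof -
  have "(L_norm 2 (\<lambda>x. (norm (f x))\<^sup>2))\<^sup>2 = ((L_norm 4 f)\<^sup>2)\<^sup>2"
    using L_norm_4[OF f] by (subst L_norm_2) (intro continuous_intros f | simp)+
  then show ?thesis
    using L_norm_nonneg power2_eq_imp_eq by (metis zero_le_power2)
qed

lemma L_norm_Hoelder_4_4_2:
  fixes f :: "real \<times> real \<Rightarrow> 'a::real_normed_vector" and g :: "real \<times> real \<Rightarrow> 'b::real_normed_vector"
  assumes f: "continuous_on Omega_bar f" and g: "continuous_on Omega_bar g"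
  shows "L_norm 2 (\<lambda>x. norm (f x) * norm (g x)) \<le> L_norm 4 f * L_norm 4 g"
proof (rule power2_le_imp_le)
  have "(L_norm 2 (\<lambda>x. norm (f x) * norm (g x)))\<^sup>2
      = cell_int (\<lambda>x. norm ((norm (f x))\<^sup>2) * norm ((norm (g x))\<^sup>2))"
    by (subst L_norm_2) (intro continuous_intros f g | simp add: power_mult_distrib)+
  also have "\<dots> \<le> L_norm 2 (\<lambda>x. (norm (f x))\<^sup>2) * L_norm 2 (\<lambda>x. (norm (g x))\<^sup>2)"
    by (intro cell_int_Cauchy_Schwarz continuous_intros f g)
  also have "\<dots> = (L_norm 4 f * L_norm 4 g)\<^sup>2"
    by (simp add: L_norm_4_sq f g power_mult_distrib)
  finally show "(L_norm 2 (\<lambda>x. norm (f x) * norm (g x)))\<^sup>2 \<le> (L_norm 4 f * L_norm 4 g)\<^sup>2" .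
qed (simp add: L_norm_nonneg)

text \<open>
  Cauchy-Schwarz against the constant 1 gives the factor \<open>(2\<pi>)^(1/4)\<close>, which is at most 2.
\<close>

lemma L_norm_2_le_L_norm_4:
  fixes f :: "real \<times> real \<Rightarrow> 'a::real_normed_vector"
  assumes f: "continuous_on Omega_bar f"
  shows "L_norm 2 f \<le> 2 * L_norm 4 f"
proof -
  have one: "(L_norm 2 (\<lambda>_. 1::real))\<^sup>2 = 2 * pi"
    by (subst L_norm_2) (simp_all add: closed_cell_def content_Pair)
  have "(L_norm 2 f)\<^sup>2 = cell_int (\<lambda>x. norm ((norm (f x))\<^sup>2) * norm (1::real))"
    by (simp add: L_norm_2 f)
  also have "\<dots> \<le> (L_norm 4 f)\<^sup>2 * L_norm 2 (\<lambda>_. 1::real)"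
    unfolding L_norm_4_sq[OF f, symmetric]
    by (intro cell_int_Cauchy_Schwarz continuous_intros f)
  also have "\<dots> \<le> (L_norm 4 f)\<^sup>2 * 4"
  proof (rule mult_left_mono)
    show "L_norm 2 (\<lambda>_. 1::real) \<le> 4"
      by (rule power2_le_imp_le) (use one pi_less_4 in simp_all)
  qed simp
  finally have "(L_norm 2 f)\<^sup>2 \<le> (2 * L_norm 4 f)\<^sup>2"
    by (simp add: power_mult_distrib)
  then show ?thesis
    by (rule power2_le_imp_le) (simp add: L_norm_nonneg)
qed

section \<open>Poincare and Ladyzhenskaya inequalities\<close>

text \<open>
  The one-dimensional estimate behind both pointwise bounds below: the oscillation of a function
  is at most the integral of the modulus of its derivative.
\<close>

lemma C1_diff_le_integral_abs:
  fixes h h' :: "real \<Rightarrow> real"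
  assumes h: "\<And>s. s \<in> {p..q} \<Longrightarrow> (h has_vector_derivative h' s) (at s within {p..q})"
    and h': "continuous_on {p..q} h'"
    and "x \<in> {p..q}" "y \<in> {p..q}"
  shows "\<bar>h x - h y\<bar> \<le> integral {p..q} (\<lambda>s. \<bar>h' s\<bar>)"
proof -
  have *: "\<bar>h x - h y\<bar> \<le> integral {p..q} (\<lambda>s. \<bar>h' s\<bar>)" if "p \<le> y" "y \<le> x" "x \<le> q" for x y
  proof -
    have sub: "{y..x} \<subseteq> {p..q}" using that by auto
    have i: "(\<lambda>s. \<bar>h' s\<bar>) integrable_on {a..b}" "h' integrable_on {a..b}" if "{a..b} \<subseteq> {p..q}" for a b
      using continuous_on_subset[OF h' that]
      by (auto intro!: integrable_continuous_interval continuous_intros)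
    have "(h' has_integral h x - h y) {y..x}"
      using that h by (intro fundamental_theorem_of_calculus)
        (auto intro: has_vector_derivative_within_subset[OF _ sub])
    then have "h x - h y = integral {y..x} h'" by (simp add: integral_unique)
    also have "\<bar>\<dots>\<bar> \<le> integral {y..x} (\<lambda>s. \<bar>h' s\<bar>)"
      using integral_norm_bound_integral[of h' "{y..x}" "\<lambda>s. \<bar>h' s\<bar>"] i[OF sub] by simp
    also have "\<dots> \<le> integral {p..q} (\<lambda>s. \<bar>h' s\<bar>)"
      using i[OF sub] i[of p q] by (intro integral_subset_le sub) auto
    finally show ?thesis .
  qed
  then show ?thesis
    using *[of x y] *[of y x] assms(3,4) by (cases "y \<le> x") (auto simp: abs_minus_commute)
qed

lemma abs_le_integral_D2:
  fixes g :: "real \<times> real \<Rightarrow> real"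
  assumes g: "C1_bar g" and bdry: "\<And>x. x \<in> Omega_bar - Omega \<Longrightarrow> g x = 0" and "b \<in> {0..1}"
  shows "\<bar>g (a, b)\<bar> \<le> integral {0..1} (\<lambda>s. \<bar>D2 g (a, s)\<bar>)"
proof -
  have "continuous_on {0..1} (\<lambda>s. D2 g (a, s))"
    by (rule continuous_on_compose2[OF C1_bar_continuous(3)[OF g]])
       (auto intro!: continuous_intros simp: Omega_bar_def)
  then show ?thesis
    using C1_diff_le_integral_abs[of 0 1 "\<lambda>s. g (a, s)" "\<lambda>s. D2 g (a, s)" b 0]
      C1_bar_D2[OF g, of "(a, _)"] bdry[of "(a, 0)"] assms(3)
    by (simp add: Omega_bar_def Omega_def)
qed

text \<open>
  There is no boundary value to start from in the periodic direction, so the value at \<open>a\<close> is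
  compared with the average over the period.
\<close>

lemma abs_le_integral_D1:
  fixes g :: "real \<times> real \<Rightarrow> real"
  assumes g: "C1_bar g" and "a \<in> {0..2*pi}" "b \<in> {0..1}"
  shows "\<bar>g (a, b)\<bar> \<le> integral {0..2*pi} (\<lambda>s. \<bar>g (s, b)\<bar>) / (2 * pi)
    + integral {0..2*pi} (\<lambda>s. \<bar>D1 g (s, b)\<bar>)" (is "_ \<le> _ + ?J")
proof -
  have c: "continuous_on {0..2*pi} (\<lambda>s. h (s, b))" if "continuous_on Omega_bar h" for h :: "real \<times> real \<Rightarrow> real"
    using assms(3) by (intro continuous_on_compose2[OF that])
       (auto intro!: continuous_intros simp: Omega_bar_def)
  have "\<bar>g (a, b)\<bar> \<le> \<bar>g (y, b)\<bar> + ?J" if "y \<in> {0..2*pi}" for y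
    using C1_diff_le_integral_abs[of 0 "2*pi" "\<lambda>s. g (s, b)" "\<lambda>s. D1 g (s, b)" a y]
      C1_bar_D1[OF g, of "(_, b)"] assms that c[OF C1_bar_continuous(2)[OF g]]
    by (auto simp: Omega_bar_def has_vector_derivative_at_within)
  then have "integral {0..2*pi} (\<lambda>y. \<bar>g (a, b)\<bar>) \<le> integral {0..2*pi} (\<lambda>y. \<bar>g (y, b)\<bar> + ?J)"
    by (intro integral_le integrable_continuous_interval continuous_intros c[OF C1_bar_continuous(1)[OF g]])
  also have "\<dots> = integral {0..2*pi} (\<lambda>y. \<bar>g (y, b)\<bar>) + 2 * pi * ?J"
    by (subst integral_add)
       (auto intro!: integrable_continuous_interval continuous_intros c[OF C1_bar_continuous(1)[OF g]])
  finally show ?thesis by (simp add: field_simps)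
qed

lemma integral_param_continuous:
  fixes g :: "real \<times> real \<Rightarrow> real"
  assumes "continuous_on Omega_bar g"
  shows "continuous_on UNIV (\<lambda>a. integral {0..1} (\<lambda>b. g (a, b)))"
    and "continuous_on {0..1} (\<lambda>b. integral {0..2*pi} (\<lambda>a. g (a, b)))"
proof -
  show "continuous_on UNIV (\<lambda>a. integral {0..1} (\<lambda>b. g (a, b)))"
    using integral_continuous_on_param[of UNIV 0 1 "\<lambda>a b. g (a, b)"] assms
    by (simp add: Omega_bar_def)
  show "continuous_on {0..1} (\<lambda>b. integral {0..2*pi} (\<lambda>a. g (a, b)))"
    using integral_continuous_on_param[of "{0..1}" 0 "2*pi" "\<lambda>b a. g (a, b)"]
      continuous_on_compose2[OF assms, of "{0..1} \<times> {0..2*pi}" "\<lambda>x. (snd x, fst x)"]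
    by (force simp: Omega_bar_def case_prod_beta intro!: continuous_on_Pair continuous_on_fst continuous_on_snd continuous_on_id)
qed

lemma cell_int_abs_le_D2:
  fixes g :: "real \<times> real \<Rightarrow> real"
  assumes g: "C1_bar g" and bdry: "\<And>x. x \<in> Omega_bar - Omega \<Longrightarrow> g x = 0"
  shows "cell_int (\<lambda>x. \<bar>g x\<bar>) \<le> cell_int (\<lambda>x. \<bar>D2 g x\<bar>)"
proof -
  let ?A = "\<lambda>a. integral {0..1} (\<lambda>s. \<bar>D2 g (a, s)\<bar>)"
  have c: "continuous_on Omega_bar (\<lambda>x. \<bar>g x\<bar>)" "continuous_on Omega_bar (\<lambda>x. \<bar>D2 g x\<bar>)"
    by (intro continuous_intros C1_bar_continuous g)+
  have A: "continuous_on UNIV ?A" by (rule integral_param_continuous(1)[OF c(2)])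
  have A': "continuous_on Omega_bar (\<lambda>x. ?A (fst x))"
    by (rule continuous_on_compose2[OF A]) (auto intro: continuous_intros)
  have "cell_int (\<lambda>x. \<bar>g x\<bar>) \<le> cell_int (\<lambda>x. ?A (fst x))"
    using abs_le_integral_D2[OF g bdry] by (intro cell_int_mono c A') (auto simp: closed_cell_eq)
  also have "\<dots> = cell_int (\<lambda>x. \<bar>D2 g x\<bar>)"
    unfolding cell_int_fubini(1)[OF A'] cell_int_fubini(1)[OF c(2)] by simp
  finally show ?thesis .
qed

text \<open>
  The two pointwise bounds separate the variables: \<open>|g(a,b)| \<le> A(a)\<close> by integrating upwards from
  the wall, and \<open>|g(a,b)| \<le> B(b)\<close> by integrating along the period. Hence \<open>\<integral>g\<^sup>2 \<le> \<integral>A \<integral>B\<close>,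
  which is the two-dimensional Gagliardo-Nirenberg argument.
\<close>

lemma cell_int_square_le:
  fixes g :: "real \<times> real \<Rightarrow> real"
  assumes g: "C1_bar g" and bdry: "\<And>x. x \<in> Omega_bar - Omega \<Longrightarrow> g x = 0"
  shows "cell_int (\<lambda>x. (g x)\<^sup>2) \<le>
    cell_int (\<lambda>x. \<bar>D2 g x\<bar>) * (cell_int (\<lambda>x. \<bar>g x\<bar>) / (2 * pi) + cell_int (\<lambda>x. \<bar>D1 g x\<bar>))"
proof -
  have c: "continuous_on Omega_bar (\<lambda>x. \<bar>g x\<bar>)" "continuous_on Omega_bar (\<lambda>x. \<bar>D1 g x\<bar>)"
    "continuous_on Omega_bar (\<lambda>x. \<bar>D2 g x\<bar>)"
    by (intro continuous_intros C1_bar_continuous g)+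
  define A where "A = (\<lambda>a. integral {0..1} (\<lambda>s. \<bar>D2 g (a, s)\<bar>))"
  define B where "B = (\<lambda>b. integral {0..2*pi} (\<lambda>s. \<bar>g (s, b)\<bar>) / (2 * pi)
    + integral {0..2*pi} (\<lambda>s. \<bar>D1 g (s, b)\<bar>))"
  have A: "continuous_on UNIV A" unfolding A_def by (rule integral_param_continuous(1)[OF c(3)])
  have B: "continuous_on {0..1} B" unfolding B_def
    by (intro continuous_intros integral_param_continuous(2) c) simp
  have AB: "continuous_on Omega_bar (\<lambda>x. A (fst x) * B (snd x))"
    by (intro continuous_intros continuous_on_compose2[OF A] continuous_on_compose2[OF B])
       (auto simp: Omega_bar_def)
  have "cell_int (\<lambda>x. (g x)\<^sup>2) \<le> cell_int (\<lambda>x. A (fst x) * B (snd x))"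
  proof (intro cell_int_mono AB continuous_intros C1_bar_continuous g)
    fix x assume "x \<in> closed_cell"
    then obtain a b where x: "x = (a, b)" "a \<in> {0..2*pi}" "b \<in> {0..1}"
      by (auto simp: closed_cell_eq)
    have "\<bar>g (a, b)\<bar> \<le> A a" "\<bar>g (a, b)\<bar> \<le> B b"
      using abs_le_integral_D2[OF g bdry x(3)] abs_le_integral_D1[OF g x(2,3)]
      by (auto simp: A_def B_def)
    then have "\<bar>g (a, b)\<bar> * \<bar>g (a, b)\<bar> \<le> A a * B b" by (intro mult_mono) auto
    then show "(g x)\<^sup>2 \<le> A (fst x) * B (snd x)" by (simp add: x power2_eq_square abs_mult[symmetric])
  qed
  also have "\<dots> = integral {0..2*pi} A * integral {0..1} B"
    by (simp add: cell_int_fubini(1)[OF AB])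
  also have "integral {0..2*pi} A = cell_int (\<lambda>x. \<bar>D2 g x\<bar>)"
    by (simp add: A_def cell_int_fubini(1)[OF c(3)])
  also have "integral {0..1} B = cell_int (\<lambda>x. \<bar>g x\<bar>) / (2 * pi) + cell_int (\<lambda>x. \<bar>D1 g x\<bar>)"
    unfolding B_def cell_int_fubini(2)[OF c(1)] cell_int_fubini(2)[OF c(2)]
    by (subst integral_add)
       (auto intro!: integrable_continuous_interval continuous_intros integral_param_continuous(2) c)
  finally show ?thesis .
qed

lemma norm_D_le_norm_grad: "norm (D1 f x) \<le> norm (grad f x)" "norm (D2 f x) \<le> norm (grad f x)"
  using norm_fst_le[of "D1 f x" "D2 f x"] norm_snd_le[of "D2 f x" "D1 f x"] by (simp_all add: grad_def)

lemma continuous_grad: "C1_bar f \<Longrightarrow> continuous_on Omega_bar (grad f)"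
  unfolding grad_def by (intro continuous_intros C1_bar_continuous)

text \<open>
  The inequalities for scalar functions are applied to \<open>g = |f|\<^sup>2\<close>, whose derivatives are at most
  \<open>2 |f| |\<nabla>f|\<close>.
\<close>

lemma cell_int_D_norm_square_le:
  fixes f :: "real \<times> real \<Rightarrow> 'a::real_inner"
  assumes f: "C1_bar f"
  shows "cell_int (\<lambda>x. \<bar>D1 (\<lambda>x. f x \<bullet> f x) x\<bar>) \<le> 2 * L_norm 2 f * L_norm 2 (grad f)" (is ?A)
    and "cell_int (\<lambda>x. \<bar>D2 (\<lambda>x. f x \<bullet> f x) x\<bar>) \<le> 2 * L_norm 2 f * L_norm 2 (grad f)" (is ?B)
proof -
  note c = C1_bar_continuous[OF f] continuous_grad[OF f]
  note ff = C1_bar_bilinear[OF bounded_bilinear_inner f f]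
  have K: "x \<in> Omega_bar" if "x \<in> closed_cell" for x using that closed_cell_subset by auto
  have *: "\<bar>f x \<bullet> d + d \<bullet> f x\<bar> \<le> 2 * (norm (f x) * norm (grad f x))" if "norm d \<le> norm (grad f x)" for d x
    using Cauchy_Schwarz_ineq2[of "f x" d] mult_left_mono[OF that, of "norm (f x)"]
    by (simp add: inner_commute)
  have "cell_int (\<lambda>x. \<bar>D1 (\<lambda>x. f x \<bullet> f x) x\<bar>) \<le> cell_int (\<lambda>x. 2 * (norm (f x) * norm (grad f x)))"
    "cell_int (\<lambda>x. \<bar>D2 (\<lambda>x. f x \<bullet> f x) x\<bar>) \<le> cell_int (\<lambda>x. 2 * (norm (f x) * norm (grad f x)))"
    using * norm_D_le_norm_grad[of f] K
    by (intro cell_int_mono continuous_intros c C1_bar_continuous[OF ff];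
        simp add: D1_bilinear[OF bounded_bilinear_inner f f] D2_bilinear[OF bounded_bilinear_inner f f])+
  then show ?A ?B
    using cell_int_Cauchy_Schwarz[OF c(1) c(4)] by auto
qed

text \<open>
  Poincare inequality: for \<open>g = |f|\<^sup>2\<close> it reads \<open>\<integral>g \<le> \<integral>|\<partial>\<^sub>2 g| \<le> 2 \<parallel>f\<parallel>\<^sub>2 \<parallel>\<nabla>f\<parallel>\<^sub>2\<close>.
\<close>

lemma L_norm_2_le_grad:
  fixes f :: "real \<times> real \<Rightarrow> 'a::real_inner"
  assumes f: "C1_bar f" and bdry: "\<And>x. x \<in> Omega_bar - Omega \<Longrightarrow> f x = 0"
  shows "L_norm 2 f \<le> 2 * L_norm 2 (grad f)"
proof -
  note ff = C1_bar_bilinear[OF bounded_bilinear_inner f f]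
  have "(L_norm 2 f)\<^sup>2 = cell_int (\<lambda>x. \<bar>f x \<bullet> f x\<bar>)"
    by (simp add: L_norm_2 C1_bar_continuous f power2_norm_eq_inner)
  also have "\<dots> \<le> cell_int (\<lambda>x. \<bar>D2 (\<lambda>x. f x \<bullet> f x) x\<bar>)"
    using bdry by (intro cell_int_abs_le_D2 ff) auto
  also have "\<dots> \<le> 2 * L_norm 2 f * L_norm 2 (grad f)"
    by (rule cell_int_D_norm_square_le(2)[OF f])
  finally have "L_norm 2 f * L_norm 2 f \<le> L_norm 2 f * (2 * L_norm 2 (grad f))"
    by (simp add: power2_eq_square mult_ac)
  then show ?thesis
    using L_norm_nonneg[of 2 f] L_norm_nonneg[of 2 "grad f"]
    by (cases "L_norm 2 f = 0") (auto simp: mult_le_cancel_left)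
qed

text \<open>
  The product estimate for \<open>g = |f|\<^sup>2\<close> bounds \<open>\<parallel>f\<parallel>\<^sub>4\<^sup>4\<close> by \<open>4G\<^sup>2 (G\<^sup>2 + 4G\<^sup>2)\<close> with
  \<open>G = \<parallel>\<nabla>f\<parallel>\<^sub>2\<close>, the lower-order norm of \<open>f\<close> being absorbed by the Poincare inequality.
\<close>

lemma L_norm_4_le_grad:
  fixes f :: "real \<times> real \<Rightarrow> 'a::real_inner"
  assumes f: "C1_bar f" and bdry: "\<And>x. x \<in> Omega_bar - Omega \<Longrightarrow> f x = 0"
  shows "L_norm 4 f \<le> 3 * L_norm 2 (grad f)"
proof -
  note ff = C1_bar_bilinear[OF bounded_bilinear_inner f f]
  define G where "G = L_norm 2 (grad f)"
  define N where "N = L_norm 2 f"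
  have N: "0 \<le> N" "N \<le> 2 * G" and G: "0 \<le> G"
    using L_norm_2_le_grad[OF f bdry] by (auto simp: N_def G_def L_norm_nonneg)
  have NG: "2 * N * G \<le> 4 * G\<^sup>2" using mult_right_mono[OF N(2) G] by (simp add: power2_eq_square mult_ac)
  have "N\<^sup>2 \<le> (2 * G)\<^sup>2" using N by (intro power_mono)
  then have "N\<^sup>2 \<le> 4 * G\<^sup>2" by (simp add: power_mult_distrib)
  also have "\<dots> \<le> G\<^sup>2 * (2 * pi)" using mult_left_mono[OF pi_ge_two, of "G\<^sup>2"] by (simp add: mult.commute)
  finally have mean: "N\<^sup>2 / (2 * pi) \<le> G\<^sup>2" by (simp add: field_simps)
  have "L_norm 4 f ^ 4 = cell_int (\<lambda>x. (f x \<bullet> f x)\<^sup>2)"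
    by (subst L_norm_4) (simp_all add: C1_bar_continuous f flip: power2_norm_eq_inner power_mult)
  also have "\<dots> \<le> cell_int (\<lambda>x. \<bar>D2 (\<lambda>x. f x \<bullet> f x) x\<bar>)
      * (cell_int (\<lambda>x. \<bar>f x \<bullet> f x\<bar>) / (2 * pi) + cell_int (\<lambda>x. \<bar>D1 (\<lambda>x. f x \<bullet> f x) x\<bar>))"
    using bdry by (intro cell_int_square_le ff) auto
  also have "cell_int (\<lambda>x. \<bar>f x \<bullet> f x\<bar>) = N\<^sup>2"
    by (simp add: N_def L_norm_2 C1_bar_continuous f power2_norm_eq_inner)
  also have "cell_int (\<lambda>x. \<bar>D2 (\<lambda>x. f x \<bullet> f x) x\<bar>)
      * (N\<^sup>2 / (2 * pi) + cell_int (\<lambda>x. \<bar>D1 (\<lambda>x. f x \<bullet> f x) x\<bar>)) \<le> (4 * G\<^sup>2) * (G\<^sup>2 + 4 * G\<^sup>2)"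
    using cell_int_D_norm_square_le[OF f] NG mean
    by (intro mult_mono add_mono add_nonneg_nonneg cell_int_nonneg continuous_intros C1_bar_continuous ff)
       (auto simp: N_def G_def)
  also have "\<dots> \<le> (3 * G) ^ 4"
    by (simp add: power_mult_distrib flip: power_add)
  finally have "L_norm 4 f ^ 4 \<le> (3 * G) ^ 4" .
  then show ?thesis
    using power_mono_iff[of "L_norm 4 f" "3 * G" 4] G by (simp add: L_norm_nonneg G_def)
qed

section \<open>Weak forms of diffusion, pressure and transport\<close>

lemma cell_int_divergence:
  fixes F1 F2 :: "real \<times> real \<Rightarrow> real"
  assumes "C1_bar F1" "C1_bar F2" and "\<And>x. x \<in> Omega_bar - Omega \<Longrightarrow> F2 x = 0"
  shows "cell_int (\<lambda>x. D1 F1 x + D2 F2 x) = 0"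
  using cell_int_D2[OF assms(2,3)] by (simp add: cell_int_add C1_bar_continuous assms cell_int_D1)

lemma continuous_laplacian: "C2_bar u \<Longrightarrow> continuous_on Omega_bar (laplacian u)"
  unfolding laplacian_def C2_bar_def by (intro continuous_intros) (simp_all add: C1_bar_continuous)

lemma green_first:
  fixes \<phi> u :: "real \<times> real \<Rightarrow> 'a::real_inner"
  assumes \<phi>: "C1_bar \<phi>" and bdry: "\<And>x. x \<in> Omega_bar - Omega \<Longrightarrow> \<phi> x = 0" and u: "C2_bar u"
  shows "cell_int (\<lambda>x. \<phi> x \<bullet> laplacian u x) = - cell_int (\<lambda>x. grad \<phi> x \<bullet> grad u x)"
proof -
  have u': "C1_bar u" "C1_bar (D1 u)" "C1_bar (D2 u)" using u by (auto simp: C2_bar_def)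
  note bb = bounded_bilinear_inner
  have "0 = cell_int (\<lambda>x. D1 (\<lambda>x. \<phi> x \<bullet> D1 u x) x + D2 (\<lambda>x. \<phi> x \<bullet> D2 u x) x)"
    using bdry by (intro cell_int_divergence[symmetric] C1_bar_bilinear[OF bb] \<phi> u') simp
  also have "\<dots> = cell_int (\<lambda>x. \<phi> x \<bullet> laplacian u x + grad \<phi> x \<bullet> grad u x)"
    by (intro cell_int_cong)
       (simp add: D1_bilinear[OF bb \<phi> u'(2)] D2_bilinear[OF bb \<phi> u'(3)] laplacian_def grad_def inner_add_right)
  also have "\<dots> = cell_int (\<lambda>x. \<phi> x \<bullet> laplacian u x) + cell_int (\<lambda>x. grad \<phi> x \<bullet> grad u x)"
    by (intro cell_int_add continuous_intros continuous_laplacian continuous_grad C1_bar_continuous \<phi> u u')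
  finally show ?thesis by simp
qed

text \<open>
  The test fields for which the pressure drops out of the weak form of the momentum equations.
\<close>

definition solenoidal :: "(real \<times> real \<Rightarrow> real \<times> real) \<Rightarrow> bool" where
  "solenoidal u \<longleftrightarrow> C1_bar u \<and> (\<forall>x\<in>Omega_bar - Omega. u x = 0) \<and> (\<forall>x\<in>Omega_bar. divergence u x = 0)"

lemma solenoidal_C1: "solenoidal u \<Longrightarrow> C1_bar u"
  by (simp add: solenoidal_def)

lemma solenoidal_bdry: "solenoidal u \<Longrightarrow> x \<in> Omega_bar - Omega \<Longrightarrow> u x = 0"
  by (simp add: solenoidal_def)

lemma solenoidalI:
  assumes u: "C1_bar u" and "\<forall>x\<in>Omega_bar - Omega. u x = 0" "\<forall>x\<in>Omega. divergence u x = 0"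
  shows "solenoidal u"
proof -
  have "continuous_on Omega_bar (divergence u)"
    unfolding divergence_def by (intro continuous_intros C1_bar_continuous u)
  then have "divergence u x = 0" if "x \<in> Omega_bar" for x
    using eq_on_Omega_bar[of "divergence u" "\<lambda>_. 0" x] assms(3) that by auto
  then show ?thesis using assms by (simp add: solenoidal_def)
qed

lemma solenoidal_diff: "solenoidal u \<Longrightarrow> solenoidal v \<Longrightarrow> solenoidal (\<lambda>x. u x - v x)"
  by (auto simp: solenoidal_def C1_bar_diff divergence_def D1_diff D2_diff)
     (smt (verit, best))

lemma solenoidal_scale: "solenoidal u \<Longrightarrow> solenoidal (\<lambda>x. c *\<^sub>R u x)"
  using D1_linear[OF bounded_linear_scaleR_right, of u _ c] D2_linear[OF bounded_linear_scaleR_right, of u _ c]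
    C1_bar_linear[OF bounded_linear_scaleR_right, of u c]
  unfolding solenoidal_def divergence_def
  by (metis (no_types, lifting) distrib_left fst_scaleR mult_zero_right real_scaleR_def scaleR_zero_right snd_scaleR)

text \<open>
  Pressure gradients do no work on solenoidal fields: \<open>\<phi> \<cdot> \<nabla>p = \<nabla> \<cdot> (p \<phi>)\<close>.
\<close>

lemma cell_int_solenoidal_grad:
  assumes \<phi>: "solenoidal \<phi>" and p: "C1_bar p"
  shows "cell_int (\<lambda>x. \<phi> x \<bullet> grad p x) = 0"
proof -
  note c = solenoidal_C1[OF \<phi>]
  have 1: "C1_bar (\<lambda>x. fst (\<phi> x))" "C1_bar (\<lambda>x. snd (\<phi> x))"
    using C1_bar_linear[OF bounded_linear_fst c] C1_bar_linear[OF bounded_linear_snd c] by simp_all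
  note bb = bounded_bilinear_mult
  have "0 = cell_int (\<lambda>x. D1 (\<lambda>x. fst (\<phi> x) * p x) x + D2 (\<lambda>x. snd (\<phi> x) * p x) x)"
    using solenoidal_bdry[OF \<phi>] by (intro cell_int_divergence[symmetric] C1_bar_bilinear[OF bb] 1 p) simp
  also have "\<dots> = cell_int (\<lambda>x. \<phi> x \<bullet> grad p x)"
  proof (rule cell_int_cong)
    fix x assume x: "x \<in> Omega_bar"
    have "D1 (\<lambda>x. fst (\<phi> x) * p x) x + D2 (\<lambda>x. snd (\<phi> x) * p x) x
        = \<phi> x \<bullet> grad p x + divergence \<phi> x * p x"
      using x by (simp add: D1_bilinear[OF bb 1(1) p] D2_bilinear[OF bb 1(2) p]
        D1_linear[OF bounded_linear_fst c] D2_linear[OF bounded_linear_snd c]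
        grad_def divergence_def inner_prod_def) (simp add: algebra_simps)
    then show "D1 (\<lambda>x. fst (\<phi> x) * p x) x + D2 (\<lambda>x. snd (\<phi> x) * p x) x = \<phi> x \<bullet> grad p x"
      using \<phi> x by (simp add: solenoidal_def)
  qed
  finally show ?thesis by simp
qed

lemma continuous_advect:
  "continuous_on Omega_bar u \<Longrightarrow> C1_bar f \<Longrightarrow> continuous_on Omega_bar (advect u f)"
  unfolding advect_def by (intro continuous_intros; simp add: C1_bar_continuous)

lemma norm_advect_le: "norm (advect u f x) \<le> norm (u x) * norm (grad f x)"
proof -
  have "norm (advect u f x) \<le> \<bar>fst (u x)\<bar> * norm (D1 f x) + \<bar>snd (u x)\<bar> * norm (D2 f x)"
    unfolding advect_def using norm_triangle_ineq by (metis norm_scaleR real_norm_def)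
  also have "\<dots> = (\<bar>fst (u x)\<bar>, \<bar>snd (u x)\<bar>) \<bullet> (norm (D1 f x), norm (D2 f x))"
    by simp
  also have "\<dots> \<le> norm (\<bar>fst (u x)\<bar>, \<bar>snd (u x)\<bar>) * norm (norm (D1 f x), norm (D2 f x))"
    by (rule norm_cauchy_schwarz)
  also have "\<dots> = norm (u x) * norm (grad f x)"
    by (simp add: grad_def norm_prod_def)
  finally show ?thesis .
qed

lemma advect_inner:
  fixes f g :: "real \<times> real \<Rightarrow> 'a::real_inner"
  assumes f: "C1_bar f" and g: "C1_bar g" and x: "x \<in> Omega_bar"
  shows "advect u (\<lambda>x. f x \<bullet> g x) x = advect u f x \<bullet> g x + f x \<bullet> advect u g x"
  unfolding advect_def using x
  by (simp add: D1_bilinear[OF bounded_bilinear_inner f g] D2_bilinear[OF bounded_bilinear_inner f g]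
    inner_simps algebra_simps)

text \<open>
  Transport by a solenoidal field is skew-symmetric because \<open>u \<cdot> \<nabla>(f \<cdot> g)\<close> has integral 0.
\<close>

lemma advect_skew:
  fixes f g :: "real \<times> real \<Rightarrow> 'a::real_inner"
  assumes u: "solenoidal u" and f: "C1_bar f" and g: "C1_bar g"
  shows "cell_int (\<lambda>x. advect u f x \<bullet> g x) = - cell_int (\<lambda>x. f x \<bullet> advect u g x)"
proof -
  note c = C1_bar_continuous(1)[OF solenoidal_C1[OF u]] C1_bar_continuous(1)[OF f] C1_bar_continuous(1)[OF g]
  have "0 = cell_int (\<lambda>x. u x \<bullet> grad (\<lambda>x. f x \<bullet> g x) x)"
    by (intro cell_int_solenoidal_grad[symmetric] u C1_bar_bilinear[OF bounded_bilinear_inner] f g)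
  also have "\<dots> = cell_int (\<lambda>x. advect u f x \<bullet> g x + f x \<bullet> advect u g x)"
    by (intro cell_int_cong)
      (simp add: advect_inner[OF f g, symmetric], simp add: advect_def grad_def inner_prod_def)
  also have "\<dots> = cell_int (\<lambda>x. advect u f x \<bullet> g x) + cell_int (\<lambda>x. f x \<bullet> advect u g x)"
    by (intro cell_int_add continuous_intros continuous_advect c f g)
  finally show ?thesis by simp
qed

lemma advect_trilinear_le:
  fixes f g :: "real \<times> real \<Rightarrow> 'a::real_inner"
  assumes u: "continuous_on Omega_bar u" and f: "continuous_on Omega_bar f" and g: "C1_bar g"
  shows "\<bar>cell_int (\<lambda>x. f x \<bullet> advect u g x)\<bar> \<le> L_norm 4 f * L_norm 4 u * L_norm 2 (grad g)"
proof -
  have "\<bar>cell_int (\<lambda>x. f x \<bullet> advect u g x)\<bar>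
      \<le> cell_int (\<lambda>x. norm (norm (f x) * norm (u x)) * norm (grad g x))"
  proof (intro cell_int_abs_le continuous_intros continuous_advect continuous_grad u f g)
    fix x
    show "\<bar>f x \<bullet> advect u g x\<bar> \<le> norm (norm (f x) * norm (u x)) * norm (grad g x)"
      using Cauchy_Schwarz_ineq2[of "f x" "advect u g x"]
        mult_left_mono[OF norm_advect_le[of u g x], of "norm (f x)"]
      by (simp add: mult.assoc)
  qed
  also have "\<dots> \<le> L_norm 2 (\<lambda>x. norm (f x) * norm (u x)) * L_norm 2 (grad g)"
    by (intro cell_int_Cauchy_Schwarz continuous_intros continuous_grad u f g)
  also have "\<dots> \<le> L_norm 4 f * L_norm 4 u * L_norm 2 (grad g)"
    by (intro mult_right_mono L_norm_Hoelder_4_4_2 u f L_norm_nonneg)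
  finally show ?thesis .
qed

section \<open>The Stokes problem in weak form\<close>

text \<open>
  The weak formulation is linear in \<open>(r, v)\<close> and free of the pressure. It thus passes to difference
  quotients in time, which is how the time derivative of the Stokes field is handled.
\<close>

definition weak_stokes :: "(real \<times> real \<Rightarrow> real) \<Rightarrow> (real \<times> real \<Rightarrow> real \<times> real) \<Rightarrow> bool" where
  "weak_stokes r v \<longleftrightarrow> continuous_on Omega_bar r \<and> solenoidal v \<and>
    (\<forall>\<phi>. solenoidal \<phi> \<longrightarrow> cell_int (\<lambda>x. grad \<phi> x \<bullet> grad v x) = - cell_int (\<lambda>x. snd (\<phi> x) * r x))"

lemma stokes_momentum:
  assumes v: "stokes_solution r v" and r: "continuous_on Omega_bar r"
  obtains q where "C1_bar q" "\<And>x. x \<in> Omega_bar \<Longrightarrow> laplacian v x = grad q x + (0, r x)"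
proof -
  obtain q where q: "C1_bar q" "\<forall>x\<in>Omega. - laplacian v x = - grad q x - (0, r x)"
    using v by (auto simp: stokes_solution_def)
  have "laplacian v x = grad q x + (0, r x)" if "x \<in> Omega_bar" for x
  proof (rule eq_on_Omega_bar[OF _ _ _ that])
    show "continuous_on Omega_bar (laplacian v)"
      using v by (intro continuous_laplacian) (simp add: stokes_solution_def)
    show "continuous_on Omega_bar (\<lambda>x. grad q x + (0, r x))"
      by (intro continuous_intros continuous_grad q r)
    show "laplacian v x = grad q x + (0, r x)" if "x \<in> Omega" for x
      using q(2)[rule_format, OF that] by (simp add: algebra_simps)
  qed
  then show ?thesis using q(1) that by blast
qed

lemma stokes_solenoidal: "stokes_solution r v \<Longrightarrow> solenoidal v"
  by (intro solenoidalI) (auto simp: stokes_solution_def C2_bar_def)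

lemma stokes_weak:
  assumes v: "stokes_solution r v" and r: "continuous_on Omega_bar r"
  shows "weak_stokes r v"
  unfolding weak_stokes_def
proof (intro conjI allI impI r stokes_solenoidal[OF v])
  fix \<phi> assume \<phi>: "solenoidal \<phi>"
  obtain q where q: "C1_bar q" "\<And>x. x \<in> Omega_bar \<Longrightarrow> laplacian v x = grad q x + (0, r x)"
    using stokes_momentum[OF v r] by blast
  have c: "continuous_on Omega_bar \<phi>" by (rule C1_bar_continuous(1)[OF solenoidal_C1[OF \<phi>]])
  have "cell_int (\<lambda>x. \<phi> x \<bullet> laplacian v x) = cell_int (\<lambda>x. \<phi> x \<bullet> grad q x + snd (\<phi> x) * r x)"
    by (intro cell_int_cong) (simp add: q(2) inner_prod_def algebra_simps)
  also have "\<dots> = cell_int (\<lambda>x. snd (\<phi> x) * r x)"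
    by (subst cell_int_add)
       (auto intro!: continuous_intros c r q continuous_grad simp: cell_int_solenoidal_grad[OF \<phi> q(1)])
  finally show "cell_int (\<lambda>x. grad \<phi> x \<bullet> grad v x) = - cell_int (\<lambda>x. snd (\<phi> x) * r x)"
    using green_first[OF solenoidal_C1[OF \<phi>] solenoidal_bdry[OF \<phi>], of v] v
    by (simp add: stokes_solution_def)
qed

lemma grad_diff: "C1_bar f \<Longrightarrow> C1_bar g \<Longrightarrow> x \<in> Omega_bar \<Longrightarrow> grad (\<lambda>x. f x - g x) x = grad f x - grad g x"
  by (simp add: grad_def D1_diff D2_diff)

lemma grad_scale: "C1_bar f \<Longrightarrow> x \<in> Omega_bar \<Longrightarrow> grad (\<lambda>x. c *\<^sub>R f x) x = c *\<^sub>R grad f x"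
  by (simp add: grad_linear[OF bounded_linear_scaleR_right], simp add: grad_def)

lemma weak_stokes_diff:
  assumes "weak_stokes r v" "weak_stokes s w"
  shows "weak_stokes (\<lambda>x. r x - s x) (\<lambda>x. v x - w x)"
proof -
  have a: "continuous_on Omega_bar r" "solenoidal v" "continuous_on Omega_bar s" "solenoidal w"
    using assms by (auto simp: weak_stokes_def)
  note C = solenoidal_C1[OF a(2)] solenoidal_C1[OF a(4)]
  show ?thesis
    unfolding weak_stokes_def
  proof (intro conjI allI impI solenoidal_diff continuous_on_diff a)
    fix \<phi> assume \<phi>: "solenoidal \<phi>"
    note c = solenoidal_C1[OF \<phi>]
    have "cell_int (\<lambda>x. grad \<phi> x \<bullet> grad (\<lambda>x. v x - w x) x)
        = cell_int (\<lambda>x. grad \<phi> x \<bullet> grad v x - grad \<phi> x \<bullet> grad w x)"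
      by (intro cell_int_cong) (simp add: grad_diff C inner_diff_right)
    also have "\<dots> = cell_int (\<lambda>x. grad \<phi> x \<bullet> grad v x) - cell_int (\<lambda>x. grad \<phi> x \<bullet> grad w x)"
      by (intro cell_int_diff continuous_intros continuous_grad c C)
    also have "\<dots> = - (cell_int (\<lambda>x. snd (\<phi> x) * r x) - cell_int (\<lambda>x. snd (\<phi> x) * s x))"
      using assms \<phi> by (simp add: weak_stokes_def)
    also have "cell_int (\<lambda>x. snd (\<phi> x) * r x) - cell_int (\<lambda>x. snd (\<phi> x) * s x)
        = cell_int (\<lambda>x. snd (\<phi> x) * (r x - s x))"
      unfolding right_diff_distrib
      by (intro cell_int_diff[symmetric] continuous_intros a C1_bar_continuous(1)[OF c])
    finally show "cell_int (\<lambda>x. grad \<phi> x \<bullet> grad (\<lambda>x. v x - w x) x)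
        = - cell_int (\<lambda>x. snd (\<phi> x) * (r x - s x))" .
  qed
qed

lemma weak_stokes_scale:
  assumes "weak_stokes r v"
  shows "weak_stokes (\<lambda>x. c * r x) (\<lambda>x. c *\<^sub>R v x)"
proof -
  have a: "continuous_on Omega_bar r" "solenoidal v"
    using assms by (auto simp: weak_stokes_def)
  show ?thesis
    unfolding weak_stokes_def
  proof (intro conjI allI impI solenoidal_scale continuous_intros a)
    fix \<phi> assume \<phi>: "solenoidal \<phi>"
    have "cell_int (\<lambda>x. grad \<phi> x \<bullet> grad (\<lambda>x. c *\<^sub>R v x) x) = cell_int (\<lambda>x. c * (grad \<phi> x \<bullet> grad v x))"
      by (intro cell_int_cong) (simp add: grad_scale solenoidal_C1 a)
    also have "\<dots> = - (c * cell_int (\<lambda>x. snd (\<phi> x) * r x))"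
      using assms \<phi> by (simp add: weak_stokes_def)
    finally show "cell_int (\<lambda>x. grad \<phi> x \<bullet> grad (\<lambda>x. c *\<^sub>R v x) x) = - cell_int (\<lambda>x. snd (\<phi> x) * (c * r x))"
      by (simp add: mult.left_commute)
  qed
qed

text \<open>
  The Stokes field itself is an admissible test field.
\<close>

lemma weak_stokes_energy:
  assumes "weak_stokes r v"
  shows "(L_norm 2 (grad v))\<^sup>2 = - cell_int (\<lambda>x. snd (v x) * r x)"
  using assms by (simp add: weak_stokes_def L_norm_2 continuous_grad solenoidal_C1 power2_norm_eq_inner)

lemma abs_cell_int_snd_mult_le:
  assumes v: "solenoidal v" and r: "continuous_on Omega_bar r"
  shows "\<bar>cell_int (\<lambda>x. snd (v x) * r x)\<bar> \<le> 2 * L_norm 2 (grad v) * L_norm 2 r"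
proof -
  note c = C1_bar_continuous(1)[OF solenoidal_C1[OF v]]
  have "\<bar>cell_int (\<lambda>x. snd (v x) * r x)\<bar> \<le> cell_int (\<lambda>x. norm (v x) * norm (r x))"
    by (intro cell_int_abs_le continuous_intros c r)
       (metis abs_mult mult_right_mono norm_ge_zero norm_snd_le prod.collapse real_norm_def)
  also have "\<dots> \<le> L_norm 2 v * L_norm 2 r"
    by (rule cell_int_Cauchy_Schwarz[OF c r])
  also have "\<dots> \<le> 2 * L_norm 2 (grad v) * L_norm 2 r"
    by (intro mult_right_mono L_norm_2_le_grad solenoidal_C1 solenoidal_bdry v L_norm_nonneg)
  finally show ?thesis .
qed

text \<open>
  If the forcing is \<open>-u \<cdot> \<nabla>f = -\<nabla> \<cdot> (f u)\<close> up to a small error, the derivative can be moved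
  from \<open>f\<close> to the test field \<open>v\<close>. Up to that error, the bound involves \<open>f\<close> but not its gradient.
\<close>

lemma weak_stokes_bound:
  assumes s: "weak_stokes r v" and u: "solenoidal u" and f: "C1_bar f"
  shows "L_norm 2 (grad v) \<le> L_norm 4 f * L_norm 4 u + 2 * L_norm 2 (\<lambda>x. r x + advect u f x)"
proof -
  have v: "solenoidal v" and r: "continuous_on Omega_bar r" using s by (auto simp: weak_stokes_def)
  have v2: "C1_bar (\<lambda>x. snd (v x))"
    using C1_bar_linear[OF bounded_linear_snd solenoidal_C1[OF v]] by simp
  note c = C1_bar_continuous(1)[OF v2] C1_bar_continuous(1)[OF solenoidal_C1[OF u]] C1_bar_continuous(1)[OF f]
  have ca: "continuous_on Omega_bar (advect u f)" by (intro continuous_advect c f)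
  define G where "G = L_norm 2 (grad v)"
  have G: "0 \<le> G" by (simp add: G_def L_norm_nonneg)
  have split: "G\<^sup>2 = cell_int (\<lambda>x. advect u f x \<bullet> snd (v x)) - cell_int (\<lambda>x. snd (v x) * (r x + advect u f x))"
  proof -
    have "G\<^sup>2 = cell_int (\<lambda>x. advect u f x \<bullet> snd (v x) - snd (v x) * (r x + advect u f x))"
      unfolding G_def weak_stokes_energy[OF s] by (simp add: distrib_left mult.commute)
    also have "\<dots> = cell_int (\<lambda>x. advect u f x \<bullet> snd (v x)) - cell_int (\<lambda>x. snd (v x) * (r x + advect u f x))"
      by (intro cell_int_diff continuous_intros c ca r)
    finally show ?thesis .
  qed
  have "cell_int (\<lambda>x. advect u f x \<bullet> snd (v x)) = - cell_int (\<lambda>x. f x \<bullet> advect u (\<lambda>x. snd (v x)) x)"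
    by (rule advect_skew[OF u f v2])
  also have "\<dots> \<le> L_norm 4 f * L_norm 4 u * L_norm 2 (grad (\<lambda>x. snd (v x)))"
    using advect_trilinear_le[OF c(2,3) v2] by linarith
  also have "\<dots> \<le> L_norm 4 f * L_norm 4 u * G"
    unfolding G_def
  proof (intro mult_left_mono L_norm_2_le continuous_grad v2 solenoidal_C1 v mult_nonneg_nonneg L_norm_nonneg)
    fix x assume "x \<in> closed_cell"
    then have "x \<in> Omega_bar" using closed_cell_subset by blast
    then show "norm (grad (\<lambda>x. snd (v x)) x) \<le> norm (grad v x)"
      using norm_snd_le[of "snd (D1 v x)" "fst (D1 v x)"] norm_snd_le[of "snd (D2 v x)" "fst (D2 v x)"]
      by (simp add: grad_linear[OF bounded_linear_snd solenoidal_C1[OF v]], simp add: grad_def norm_Pair)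
         (intro real_sqrt_le_mono add_mono, auto simp flip: abs_le_square_iff)
  qed
  finally have transport: "cell_int (\<lambda>x. advect u f x \<bullet> snd (v x)) \<le> L_norm 4 f * L_norm 4 u * G" .
  have "- cell_int (\<lambda>x. snd (v x) * (r x + advect u f x)) \<le> 2 * G * L_norm 2 (\<lambda>x. r x + advect u f x)"
    using abs_cell_int_snd_mult_le[OF v continuous_on_add[OF r ca]] by (simp add: G_def)
  with split transport have "G * G \<le> G * (L_norm 4 f * L_norm 4 u + 2 * L_norm 2 (\<lambda>x. r x + advect u f x))"
    by (simp add: algebra_simps power2_eq_square)
  moreover have "0 \<le> L_norm 4 f * L_norm 4 u + 2 * L_norm 2 (\<lambda>x. r x + advect u f x)"
    by (simp add: L_norm_nonneg)
  ultimately show ?thesis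
    using G unfolding G_def[symmetric] by (cases "G = 0") (auto simp: mult_le_cancel_left)
qed

lemma weak_stokes_bound_L2:
  assumes s: "weak_stokes r v"
  shows "L_norm 2 (grad v) \<le> 2 * L_norm 2 r"
proof -
  have v: "solenoidal v" and r: "continuous_on Omega_bar r" using s by (auto simp: weak_stokes_def)
  have "L_norm 2 (grad v) * L_norm 2 (grad v) \<le> L_norm 2 (grad v) * (2 * L_norm 2 r)"
    using weak_stokes_energy[OF s] abs_cell_int_snd_mult_le[OF v r] by (simp add: power2_eq_square algebra_simps)
  then show ?thesis
    using L_norm_nonneg[of 2 "grad v"] L_norm_nonneg[of 2 r]
    by (cases "L_norm 2 (grad v) = 0") (auto simp: mult_le_cancel_left)
qed

lemma stokes_gradient_bound:
  assumes "weak_stokes r v"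
  shows "L_norm 2 (grad v) \<le> 4 * L_norm 4 r"
proof -
  have "L_norm 2 (grad v) \<le> 2 * L_norm 2 r" by (rule weak_stokes_bound_L2[OF assms])
  also have "\<dots> \<le> 2 * (2 * L_norm 4 r)"
    using assms by (intro mult_left_mono L_norm_2_le_L_norm_4) (auto simp: weak_stokes_def)
  finally show ?thesis by simp
qed

section \<open>Differentiation in time\<close>

lemma at_within_nonneg_nontrivial: "t \<ge> 0 \<Longrightarrow> at t within {0..} \<noteq> bot" for t :: real
proof -
  assume "t \<ge> 0"
  then have "at_right t \<le> at t within {0..}" by (intro at_le) auto
  then show ?thesis using trivial_limit_at_right_real[of t] by (auto simp: bot_unique)
qed

lemma jointly_continuous_iff:
  "jointly_continuous f \<longleftrightarrow> continuous_on ({0..} \<times> Omega_bar) (\<lambda>z. f (fst z) (snd z))"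
  by (simp add: jointly_continuous_def case_prod_beta)

lemma jointly_continuous_slice:
  assumes "jointly_continuous f" "t \<ge> 0"
  shows "continuous_on Omega_bar (f t)"
  using assms(1) unfolding jointly_continuous_iff
  by (rule continuous_on_compose2[where f="Pair t" and g="\<lambda>z. f (fst z) (snd z)", simplified])
     (use assms(2) in \<open>auto intro: continuous_intros\<close>)

lemma C1_time_derivative:
  assumes "C1_time f" "t \<ge> 0" "x \<in> Omega_bar"
  shows "((\<lambda>s. f s x) has_vector_derivative Dt f t x) (at t within {0..})"
  using assms by (simp add: C1_time_def Dt_def vector_derivative_works)

lemma C1_time_continuous:
  assumes "C1_time f" "t \<ge> 0"
  shows "continuous_on Omega_bar (f t)" "continuous_on Omega_bar (Dt f t)"
  using assms jointly_continuous_slice by (auto simp: C1_time_def)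

lemma cell_int_has_derivative:
  assumes f: "\<And>s x. s \<ge> 0 \<Longrightarrow> x \<in> Omega_bar \<Longrightarrow> ((\<lambda>s. f s x) has_real_derivative f' s x) (at s within {0..})"
    and c: "\<And>s. s \<ge> 0 \<Longrightarrow> continuous_on Omega_bar (f s)"
    and f': "jointly_continuous f'" and t: "t \<ge> 0"
  shows "((\<lambda>s. cell_int (f s)) has_real_derivative cell_int (f' t)) (at t within {0..})"
  unfolding closed_cell_def
proof (rule leibniz_rule_field_derivative)
  show "((\<lambda>s. f s x) has_real_derivative f' s x) (at s within {0..})"
    if "s \<in> {0..}" "x \<in> cbox (0, 0) (2 * pi, 1)" for s x
    using f[of s x] that closed_cell_subset by (auto simp: closed_cell_def)
  show "f s integrable_on cbox (0, 0) (2 * pi, 1)" if "s \<in> {0..}" for s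
    using cell_integrable[OF c[of s]] that by (simp add: closed_cell_def)
  show "continuous_on ({0..} \<times> cbox (0, 0) (2 * pi, 1)) (\<lambda>(s, x). f' s x)"
    using f' closed_cell_subset unfolding jointly_continuous_def closed_cell_def
    by (elim continuous_on_subset) blast
qed (use t in auto)

lemma cell_int_inner_has_derivative:
  fixes f g :: "real \<Rightarrow> real \<times> real \<Rightarrow> 'a::real_inner"
  assumes f: "C1_time f" and g: "C1_time g" and t: "t \<ge> 0"
  shows "((\<lambda>s. cell_int (\<lambda>x. f s x \<bullet> g s x)) has_real_derivative
    cell_int (\<lambda>x. f t x \<bullet> Dt g t x + Dt f t x \<bullet> g t x)) (at t within {0..})"
proof (rule cell_int_has_derivative[OF _ _ _ t])
  show "((\<lambda>s. f s x \<bullet> g s x) has_real_derivative f s x \<bullet> Dt g s x + Dt f s x \<bullet> g s x) (at s within {0..})"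
    if "s \<ge> 0" "x \<in> Omega_bar" for s x
    using bounded_bilinear.has_vector_derivative[OF bounded_bilinear_inner
        C1_time_derivative[OF f that] C1_time_derivative[OF g that]]
    by (simp add: has_real_derivative_iff_has_vector_derivative)
  show "continuous_on Omega_bar (\<lambda>x. f s x \<bullet> g s x)" if "s \<ge> 0" for s
    by (intro continuous_intros C1_time_continuous f g that)
  show "jointly_continuous (\<lambda>s x. f s x \<bullet> Dt g s x + Dt f s x \<bullet> g s x)"
    using f g unfolding C1_time_def jointly_continuous_iff by (intro continuous_intros) auto
qed

lemma C1_time_const:
  assumes "continuous_on Omega_bar f"
  shows "C1_time (\<lambda>s. f)" "t \<ge> 0 \<Longrightarrow> Dt (\<lambda>s. f) t x = 0"
proof -
  show *: "Dt (\<lambda>s. f) t x = 0" if "t \<ge> 0" for t x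
    unfolding Dt_def
    using at_within_nonneg_nontrivial[OF that]
    by (simp add: vector_derivative_within has_vector_derivative_const)
  have "jointly_continuous (\<lambda>s. f)"
    unfolding jointly_continuous_iff
    by (rule continuous_on_compose2[OF assms]) (auto intro: continuous_intros)
  moreover have "jointly_continuous (Dt (\<lambda>s. f))"
    unfolding jointly_continuous_iff
    by (rule continuous_on_eq[of _ "\<lambda>_. 0"]) (auto simp: *)
  ultimately show "C1_time (\<lambda>s. f)"
    by (simp add: C1_time_def)
qed

lemma C1_time_diff_const:
  assumes f: "C1_time f" and g: "continuous_on Omega_bar g"
  shows "C1_time (\<lambda>s x. f s x - g x)"
proof -
  have d: "((\<lambda>s. f s x - g x) has_vector_derivative Dt f t x) (at t within {0..})"
    if "t \<ge> 0" "x \<in> Omega_bar" for t x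
    using has_vector_derivative_diff[OF C1_time_derivative[OF f that] has_vector_derivative_const[of "g x"]]
    by simp
  have *: "Dt (\<lambda>s x. f s x - g x) t x = Dt f t x" if "t \<ge> 0" "x \<in> Omega_bar" for t x
    unfolding Dt_def[of "\<lambda>s x. f s x - g x"]
    using at_within_nonneg_nontrivial[OF that(1)] d[OF that] by (rule vector_derivative_within)
  have "jointly_continuous (\<lambda>s x. f s x - g x)"
    using f unfolding C1_time_def jointly_continuous_iff
    by (intro continuous_intros continuous_on_compose2[OF g]) auto
  moreover have "jointly_continuous (Dt (\<lambda>s x. f s x - g x))"
    unfolding jointly_continuous_iff
    by (rule continuous_on_eq[of _ "\<lambda>z. Dt f (fst z) (snd z)"])
       (use f in \<open>auto simp: * C1_time_def jointly_continuous_iff\<close>)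
  ultimately show ?thesis
    using differentiableI_vector[OF d] by (auto simp: C1_time_def)
qed

lemma L_norm_2_increment_has_derivative_0:
  fixes f :: "real \<Rightarrow> real \<times> real \<Rightarrow> 'a::real_inner"
  assumes f: "C1_time f" and t: "t \<ge> 0"
  shows "((\<lambda>s. (L_norm 2 (\<lambda>x. f s x - f t x))\<^sup>2) has_real_derivative 0) (at t within {0..})"
proof -
  note g = C1_time_diff_const[OF f C1_time_continuous(1)[OF f t]]
  have "((\<lambda>s. cell_int (\<lambda>x. (f s x - f t x) \<bullet> (f s x - f t x))) has_real_derivative 0) (at t within {0..})"
    using cell_int_inner_has_derivative[OF g g t] by simp
  then show ?thesis
    by (rule has_field_derivative_transform_within[OF _ zero_less_one])
       (use t in \<open>simp_all add: L_norm_2 C1_time_continuous[OF g] power2_norm_eq_inner\<close>)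
qed

text \<open>
  The expansion is uniform in space since \<^term>\<open>Dt f\<close> is uniformly continuous on the compact set
  \<^term>\<open>{0..t+1} \<times> closed_cell\<close>; by the mean value theorem its modulus of continuity controls the
  remainder.
\<close>

lemma uniform_difference_quotient:
  assumes f: "C1_time f" and t: "t \<ge> 0" and \<epsilon>: "\<epsilon> > 0"
  shows "\<exists>\<delta>>0. \<forall>s\<ge>0. \<bar>s - t\<bar> < \<delta> \<longrightarrow>
    (\<forall>x\<in>closed_cell. norm (f s x - f t x - (s - t) *\<^sub>R Dt f t x) \<le> \<bar>s - t\<bar> * \<epsilon>)"
proof -
  let ?K = "{0..t+1} \<times> closed_cell"
  have "continuous_on ?K (\<lambda>z. Dt f (fst z) (snd z))"
    using f closed_cell_subset unfolding C1_time_def jointly_continuous_iff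
    by (elim conjE continuous_on_subset) auto
  then have "uniformly_continuous_on ?K (\<lambda>z. Dt f (fst z) (snd z))"
    by (rule compact_uniformly_continuous) (intro compact_Times compact_Icc compact_closed_cell)
  then obtain d where d: "d > 0" and dist: "\<And>z z'. z \<in> ?K \<Longrightarrow> z' \<in> ?K \<Longrightarrow> dist z' z < d \<Longrightarrow>
      dist (Dt f (fst z') (snd z')) (Dt f (fst z) (snd z)) < \<epsilon>"
    using \<epsilon> unfolding uniformly_continuous_on_def by blast
  show ?thesis
  proof (intro exI[of _ "min d 1"] conjI allI impI ballI)
    fix s x assume s: "0 \<le> s" "\<bar>s - t\<bar> < min d 1" and x: "x \<in> closed_cell"
    then have xb: "x \<in> Omega_bar" using closed_cell_subset by auto
    have seg: "y \<ge> 0 \<and> y \<le> t + 1 \<and> \<bar>y - t\<bar> < d" if "y \<in> closed_segment t s" for y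
      using that s t by (auto simp: closed_segment_eq_real_ivl split: if_splits)
    have "norm (f s x - f t x - (s - t) *\<^sub>R Dt f t x) \<le> norm (s - t) * \<epsilon>"
    proof (rule vector_differentiable_bound_linearization[where S="closed_segment t s"])
      fix y assume y: "y \<in> closed_segment t s"
      have "((\<lambda>s. f s x) has_vector_derivative Dt f y x) (at y within {0..})"
        using C1_time_derivative[OF f _ xb] seg[OF y] by blast
      then show "((\<lambda>s. f s x) has_vector_derivative Dt f y x) (at y within closed_segment t s)"
        by (rule has_vector_derivative_within_subset) (use seg in auto)
      show "norm (Dt f y x - Dt f t x) \<le> \<epsilon>"
        using dist[of "(t, x)" "(y, x)"] seg[OF y] x t
        by (simp add: dist_Pair_Pair dist_norm less_imp_le)
    qed auto
    then show "norm (f s x - f t x - (s - t) *\<^sub>R Dt f t x) \<le> \<bar>s - t\<bar> * \<epsilon>" by simp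
  qed (use d in auto)
qed

lemma L_norm_2_difference_quotient_tendsto_0:
  fixes \<rho> :: "real \<Rightarrow> real \<times> real \<Rightarrow> real"
  assumes \<rho>: "C1_time \<rho>" and t: "t \<ge> 0"
  shows "((\<lambda>s. L_norm 2 (\<lambda>x. (\<rho> s x - \<rho> t x) / (s - t) - Dt \<rho> t x)) \<longlongrightarrow> 0) (at t within {0..})"
proof (rule tendstoI)
  fix e :: real assume e: "e > 0"
  \<comment> \<open>The constant field of size \<open>\<epsilon>\<close> has norm at most \<open>3 \<epsilon>\<close> on the cell, of area \<open>2\<pi> < 9\<close>.\<close>
  define \<epsilon> where "\<epsilon> = e / 6"
  have \<epsilon>: "\<epsilon> > 0" using e by (simp add: \<epsilon>_def)
  obtain \<delta> where \<delta>: "\<delta> > 0" and lin: "\<And>s x. s \<ge> 0 \<Longrightarrow> \<bar>s - t\<bar> < \<delta> \<Longrightarrow> x \<in> closed_cell \<Longrightarrow>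
      \<bar>\<rho> s x - \<rho> t x - (s - t) * Dt \<rho> t x\<bar> \<le> \<bar>s - t\<bar> * \<epsilon>"
    using uniform_difference_quotient[OF \<rho> t \<epsilon>] by auto
  have const: "L_norm 2 (\<lambda>_. \<epsilon>) \<le> 3 * \<epsilon>"
  proof (rule power2_le_imp_le)
    show "(L_norm 2 (\<lambda>_. \<epsilon>))\<^sup>2 \<le> (3 * \<epsilon>)\<^sup>2"
      using pi_less_4 mult_right_mono[of "2 * pi" 9 "\<epsilon>\<^sup>2"]
      by (subst L_norm_2) (simp_all add: closed_cell_def content_Pair power_mult_distrib)
  qed (use \<epsilon> in simp)
  have "L_norm 2 (\<lambda>x. (\<rho> s x - \<rho> t x) / (s - t) - Dt \<rho> t x) < e"
    if s: "s \<in> {0..}" "s \<noteq> t" "dist s t < \<delta>" for s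
  proof -
    have "L_norm 2 (\<lambda>x. (\<rho> s x - \<rho> t x) / (s - t) - Dt \<rho> t x) \<le> L_norm 2 (\<lambda>_. \<epsilon>)"
    proof (rule L_norm_2_le)
      show "continuous_on Omega_bar (\<lambda>x. (\<rho> s x - \<rho> t x) / (s - t) - Dt \<rho> t x)"
        using s t by (intro continuous_intros C1_time_continuous \<rho>) auto
      fix x assume x: "x \<in> closed_cell"
      have "(\<rho> s x - \<rho> t x) / (s - t) - Dt \<rho> t x = (\<rho> s x - \<rho> t x - (s - t) * Dt \<rho> t x) / (s - t)"
        using s by (simp add: field_simps)
      then have "\<bar>(\<rho> s x - \<rho> t x) / (s - t) - Dt \<rho> t x\<bar>
          = \<bar>\<rho> s x - \<rho> t x - (s - t) * Dt \<rho> t x\<bar> / \<bar>s - t\<bar>"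
        by simp
      also have "\<dots> \<le> \<epsilon>"
        using lin[OF _ _ x, of s] s by (simp add: dist_real_def divide_le_eq mult.commute)
      finally show "norm ((\<rho> s x - \<rho> t x) / (s - t) - Dt \<rho> t x) \<le> norm \<epsilon>"
        using \<epsilon> by simp
    qed simp
    then show ?thesis using const \<epsilon> by (simp add: \<epsilon>_def)
  qed
  then show "\<forall>\<^sub>F s in at t within {0..}.
      dist (L_norm 2 (\<lambda>x. (\<rho> s x - \<rho> t x) / (s - t) - Dt \<rho> t x)) 0 < e"
    unfolding eventually_at using \<delta> by (auto simp: L_norm_nonneg)
qed

text \<open>
  Cauchy criterion along a filter, with the modulus given by a function that tends to 0.
\<close>

lemma tendsto_exists_of_modulus:
  fixes g e :: "'a \<Rightarrow> real"
  assumes F: "F \<noteq> bot" and A: "eventually (\<lambda>s. s \<in> A) F" and e: "(e \<longlongrightarrow> 0) F"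
    and g: "\<And>s r. s \<in> A \<Longrightarrow> r \<in> A \<Longrightarrow> \<bar>g s - g r\<bar> \<le> e s + e r"
  shows "\<exists>L. (g \<longlongrightarrow> L) F"
proof -
  have "cauchy_filter (filtermap g F)"
    unfolding cauchy_filter_metric_filtermap
  proof (intro allI impI)
    fix \<epsilon> :: real assume "\<epsilon> > 0"
    then have "eventually (\<lambda>s. s \<in> A \<and> \<bar>e s\<bar> < \<epsilon> / 2) F"
      using A tendstoD[OF e, of "\<epsilon> / 2"] by (auto elim: eventually_elim2)
    moreover have "dist (g s) (g r) < \<epsilon>" if "s \<in> A \<and> \<bar>e s\<bar> < \<epsilon> / 2" "r \<in> A \<and> \<bar>e r\<bar> < \<epsilon> / 2" for s r
      using g[of s r] that unfolding dist_real_def by linarith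
    ultimately show "\<exists>P. eventually P F \<and> (\<forall>x y. P x \<and> P y \<longrightarrow> dist (g x) (g y) < \<epsilon>)"
      by blast
  qed
  moreover have "filtermap g F \<noteq> bot" using F by (simp add: filtermap_bot_iff)
  ultimately show ?thesis
    using cauchy_filter_complete_converges[of "filtermap g F" UNIV] complete_UNIV
    by (auto simp: filterlim_def)
qed

lemma abs_cell_int_inner_le:
  fixes f g :: "real \<times> real \<Rightarrow> 'a::real_inner"
  assumes "continuous_on Omega_bar f" "continuous_on Omega_bar g"
  shows "\<bar>cell_int (\<lambda>x. f x \<bullet> g x)\<bar> \<le> L_norm 2 f * L_norm 2 g"
proof -
  have "\<bar>cell_int (\<lambda>x. f x \<bullet> g x)\<bar> \<le> cell_int (\<lambda>x. norm (f x) * norm (g x))"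
    by (intro cell_int_abs_le continuous_intros assms Cauchy_Schwarz_ineq2)
  also have "\<dots> \<le> L_norm 2 f * L_norm 2 g"
    by (rule cell_int_Cauchy_Schwarz[OF assms])
  finally show ?thesis .
qed

text \<open>
  The field \<open>v\<close> is given separately at each time, so \<open>v\<^sub>t\<close> enters only through the limit of
  \<open>\<integral>w \<cdot> (v(s) - v(t))/(s - t)\<close>. The difference quotients of \<open>v\<close> solve the Stokes problem
  with the difference quotients of \<open>\<rho>\<close> as forcing. The latter converge in \<open>L\<^sup>2\<close>, so the former are
  Cauchy by linearity and the energy estimate, and the limit exists. Since the limit forcing is
  \<open>\<rho>\<^sub>t = - u \<cdot> \<nabla>\<rho>\<close>, the bound does not involve derivatives of \<open>\<rho>\<close>.
\<close>

lemma stokes_velocity_weakly_differentiable: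
  fixes v :: "real \<Rightarrow> real \<times> real \<Rightarrow> real \<times> real"
  assumes \<rho>: "C1_time \<rho>" and v: "\<And>s. s \<ge> 0 \<Longrightarrow> weak_stokes (\<rho> s) (v s)" and t: "t \<ge> 0"
    and u: "solenoidal u" and \<rho>t: "C1_bar (\<rho> t)"
    and transport: "\<And>x. x \<in> Omega_bar \<Longrightarrow> Dt \<rho> t x + advect u (\<rho> t) x = 0"
    and w: "continuous_on Omega_bar w"
  shows "\<exists>L. ((\<lambda>s. cell_int (\<lambda>x. w x \<bullet> (v s x - v t x)) / (s - t)) \<longlongrightarrow> L) (at t within {0..})
    \<and> \<bar>L\<bar> \<le> 2 * L_norm 2 w * (L_norm 4 (\<rho> t) * L_norm 4 u)"
proof -
  let ?F = "at t within {0..}"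
  define q where "q s x = (\<rho> s x - \<rho> t x) / (s - t)" for s x
  define d where "d s x = (1 / (s - t)) *\<^sub>R (v s x - v t x)" for s x
  define e where "e s = L_norm 2 (\<lambda>x. q s x - Dt \<rho> t x)" for s
  define g where "g s = cell_int (\<lambda>x. w x \<bullet> d s x)" for s
  have g_eq: "g s = cell_int (\<lambda>x. w x \<bullet> (v s x - v t x)) / (s - t)" for s
    by (simp add: g_def d_def)
  have e0: "(e \<longlongrightarrow> 0) ?F"
    unfolding e_def[abs_def] q_def using \<rho> t by (rule L_norm_2_difference_quotient_tendsto_0)
  have qd: "weak_stokes (q s) (d s)" if "s \<ge> 0" for s
    using weak_stokes_scale[OF weak_stokes_diff[OF v[OF that] v[OF t]], of "1 / (s - t)"]
    by (simp add: q_def[abs_def] d_def[abs_def])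
  have q: "continuous_on Omega_bar (q s)" and dsol: "solenoidal (d s)"
    and d: "continuous_on Omega_bar (d s)" if "s \<ge> 0" for s
    using qd[OF that] C1_bar_continuous(1)[OF solenoidal_C1] by (auto simp: weak_stokes_def)
  note \<rho>' = C1_time_continuous(2)[OF \<rho> t]
  have Poinc: "L_norm 2 z \<le> 2 * L_norm 2 (grad z)" if "solenoidal z" for z
    using L_norm_2_le_grad[OF solenoidal_C1[OF that] solenoidal_bdry[OF that]] by blast
  have cauchy: "\<bar>g s - g r\<bar> \<le> L_norm 2 w * (4 * e s) + L_norm 2 w * (4 * e r)"
    if s: "s \<in> {0..}" and r: "r \<in> {0..}" for s r
  proof -
    have s0: "s \<ge> 0" and r0: "r \<ge> 0" using s r by auto
    have "g s - g r = cell_int (\<lambda>x. w x \<bullet> (d s x - d r x))"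
      unfolding g_def inner_diff_right
      by (intro cell_int_diff[symmetric] continuous_intros w d s0 r0)
    then have "\<bar>g s - g r\<bar> \<le> L_norm 2 w * L_norm 2 (\<lambda>x. d s x - d r x)"
      using abs_cell_int_inner_le[OF w continuous_on_diff[OF d[OF s0] d[OF r0]]] by simp
    also have "L_norm 2 w * L_norm 2 (\<lambda>x. d s x - d r x) \<le> L_norm 2 w * (4 * e s + 4 * e r)"
    proof (rule mult_left_mono[OF _ L_norm_nonneg])
      have "L_norm 2 (\<lambda>x. d s x - d r x) \<le> 2 * L_norm 2 (grad (\<lambda>x. d s x - d r x))"
        by (intro Poinc solenoidal_diff dsol s0 r0)
      moreover have "L_norm 2 (grad (\<lambda>x. d s x - d r x)) \<le> 2 * L_norm 2 (\<lambda>x. q s x - q r x)"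
        by (intro weak_stokes_bound_L2 weak_stokes_diff qd s0 r0)
      moreover have "L_norm 2 (\<lambda>x. (q s x - Dt \<rho> t x) - (q r x - Dt \<rho> t x)) \<le> e s + e r"
        unfolding e_def by (intro L_norm_2_diff_le continuous_intros q \<rho>' s0 r0)
      ultimately show "L_norm 2 (\<lambda>x. d s x - d r x) \<le> 4 * e s + 4 * e r"
        by simp
    qed
    finally show ?thesis by (simp add: distrib_left)
  qed
  have "((\<lambda>s. L_norm 2 w * (4 * e s)) \<longlongrightarrow> L_norm 2 w * (4 * 0)) ?F"
    by (intro tendsto_intros e0)
  then obtain L where L: "(g \<longlongrightarrow> L) ?F"
    using tendsto_exists_of_modulus[OF at_within_nonneg_nontrivial[OF t], of "{0..}" "\<lambda>s. L_norm 2 w * (4 * e s)" g]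
      cauchy by (auto simp: eventually_at_filter)
  have bound: "\<bar>g s\<bar> \<le> 2 * L_norm 2 w * (L_norm 4 (\<rho> t) * L_norm 4 u + 2 * e s)" if "s \<ge> 0" for s
  proof -
    have force: "L_norm 2 (\<lambda>x. q s x + advect u (\<rho> t) x) \<le> e s"
      unfolding e_def
    proof (intro L_norm_2_le continuous_intros q that \<rho>' continuous_advect \<rho>t C1_bar_continuous(1)[OF solenoidal_C1[OF u]])
      fix x assume "x \<in> closed_cell"
      then have "x \<in> Omega_bar" using closed_cell_subset by blast
      then have "advect u (\<rho> t) x = - Dt \<rho> t x" using transport[of x] by linarith
      then show "norm (q s x + advect u (\<rho> t) x) \<le> norm (q s x - Dt \<rho> t x)" by simp
    qed
    have "\<bar>g s\<bar> \<le> L_norm 2 w * L_norm 2 (d s)"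
      unfolding g_def by (intro abs_cell_int_inner_le w d that)
    also have "\<dots> \<le> L_norm 2 w * (2 * (L_norm 4 (\<rho> t) * L_norm 4 u + 2 * e s))"
    proof (rule mult_left_mono[OF _ L_norm_nonneg])
      have "L_norm 2 (d s) \<le> 2 * L_norm 2 (grad (d s))"
        by (intro Poinc dsol that)
      moreover have "L_norm 2 (grad (d s)) \<le> L_norm 4 (\<rho> t) * L_norm 4 u
          + 2 * L_norm 2 (\<lambda>x. q s x + advect u (\<rho> t) x)"
        by (rule weak_stokes_bound[OF qd[OF that] u \<rho>t])
      ultimately show "L_norm 2 (d s) \<le> 2 * (L_norm 4 (\<rho> t) * L_norm 4 u + 2 * e s)"
        using force by simp
    qed
    finally show ?thesis by (simp add: algebra_simps)
  qed
  have "((\<lambda>s. 2 * L_norm 2 w * (L_norm 4 (\<rho> t) * L_norm 4 u + 2 * e s)) \<longlongrightarrow>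
      2 * L_norm 2 w * (L_norm 4 (\<rho> t) * L_norm 4 u + 2 * 0)) ?F"
    by (intro tendsto_intros e0)
  moreover have "((\<lambda>s. \<bar>g s\<bar>) \<longlongrightarrow> \<bar>L\<bar>) ?F"
    by (intro tendsto_intros L)
  ultimately have "\<bar>L\<bar> \<le> 2 * L_norm 2 w * (L_norm 4 (\<rho> t) * L_norm 4 u + 2 * 0)"
    using bound by (intro tendsto_le[OF at_within_nonneg_nontrivial[OF t]])
      (auto simp: eventually_at_filter)
  then show ?thesis using L unfolding g_eq[abs_def] by auto
qed

section \<open>Integrability of the rearranged density\<close>

lemma rearr_nonneg_eq_measure:
  "rearr_nonneg r x = measure lborel ({0..} \<inter> {s. 0 \<le> snd x \<and> snd x \<le> measure lborel {y\<in>cell. r y > s} / (2 * pi)})"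
  (is "_ = measure lborel (_ \<inter> ?A)")
  unfolding rearr_nonneg_def set_lebesgue_integral_def
  by (simp flip: indicator_inter_arith)

text \<open>
  The rearranged density contributes an additive constant to the potential energy. The integral of
  the difference \<open>\<rho> - \<rho>\<^sub>0\<^sup>*\<close> splits only if \<open>\<rho>\<^sub>0\<^sup>*\<close> is integrable; a non-integrable function would be given
  the integral 0. Integrability holds because \<open>\<rho>\<^sub>0\<^sup>*\<close> is, up to a shift, the length of the set of levels
  whose superlevel set has relative measure at least \<open>x\<^sub>2\<close>: this is bounded, and monotone in \<open>x\<^sub>2\<close>.
\<close>

lemma set_integrable_rearr:
  fixes r :: "real \<times> real \<Rightarrow> real"
  assumes r: "continuous_on Omega_bar r"
  shows "set_integrable lborel cell (\<lambda>x. rearr r x * snd x)"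
proof -
  define c where "c = (SOME c. \<forall>y\<in>Omega. 0 \<le> r y + c)"
  define f where "f y = r y + c" for y
  define m where "m s = measure lborel {y\<in>cell. f y > s}" for s
  define A where "A b = {0..} \<inter> {s. 0 \<le> b \<and> b \<le> m s / (2 * pi)}" for b :: real
  have rearr: "rearr r x = measure lborel (A (snd x)) - c" for x
    unfolding rearr_def c_def[symmetric] Let_def f_def[symmetric] rearr_nonneg_eq_measure m_def[symmetric] A_def ..
  have f: "continuous_on Omega_bar f" unfolding f_def by (intro continuous_intros r)
  have cellO: "cell \<subseteq> Omega_bar" using cell_subset_closed_cell closed_cell_subset by blast
  have "compact (f ` closed_cell)"
    by (intro compact_continuous_image continuous_on_subset[OF f closed_cell_subset] compact_closed_cell)
  then obtain B where B: "\<And>x. x \<in> closed_cell \<Longrightarrow> f x \<le> B" "B \<ge> 0"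
    using compact_imp_bounded bounded_pos[of "f ` closed_cell"] by (force simp: abs_le_iff)
  have fm: "{y\<in>cell. f y > s} \<in> fmeasurable lborel" for s
  proof (rule fmeasurableI2)
    show "closed_cell \<in> fmeasurable lborel" by (simp add: closed_cell_def)
    show "{y\<in>cell. f y > s} \<subseteq> closed_cell" using cell_subset_closed_cell by auto
    have "f \<in> borel_measurable (restrict_space borel cell)"
      by (intro borel_measurable_continuous_on_restrict continuous_on_subset[OF f cellO])
    then have "{y \<in> space (restrict_space borel cell). f y > s} \<in> sets (restrict_space borel cell)"
      by measurable
    then show "{y\<in>cell. f y > s} \<in> sets lborel"
      by (simp add: sets_restrict_space_iff space_restrict_space)
  qed
  have m_mono: "m t \<le> m s" if "s \<le> t" for s t
    unfolding m_def using that by (intro measure_mono_fmeasurable fm fmeasurableD) auto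
  have "mono (\<lambda>s. - m s)" using m_mono by (auto intro!: monoI)
  then have "(\<lambda>s. - (- m s)) \<in> borel_measurable borel"
    by (intro borel_measurable_uminus borel_measurable_mono)
  then have m_meas [measurable]: "m \<in> borel_measurable borel" by simp
  have A_meas: "A b \<in> sets lborel" for b
    unfolding A_def by measurable
  have m0: "m s = 0" if "s \<ge> B" for s
  proof -
    have "{y\<in>cell. f y > s} = {}" using B(1) cell_subset_closed_cell that by force
    then show ?thesis unfolding m_def by (metis measure_empty)
  qed
  have A_sub: "A b \<subseteq> {0..B}" if "b > 0" for b
  proof
    fix s assume "s \<in> A b"
    then show "s \<in> {0..B}" using that m0[of s] by (cases "s \<le> B") (auto simp: A_def)
  qed
  have I_fm: "{0..B} \<in> fmeasurable lborel"
    by (metis box_real(2) fmeasurable_cbox)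
  have A_fm: "A b \<in> fmeasurable lborel" if "b > 0" for b
    by (rule fmeasurableI2[OF I_fm A_sub[OF that] A_meas])
  have A_le: "measure lborel (A b) \<le> B" if "b > 0" for b
    using measure_mono_fmeasurable[OF A_sub[OF that] A_meas I_fm] B by simp
  have A_mono: "measure lborel (A b') \<le> measure lborel (A b)" if "0 < b" "b \<le> b'" for b b'
    using that by (intro measure_mono_fmeasurable A_meas A_fm) (auto simp: A_def)
  have "mono_on {0<..<1} (\<lambda>b. - measure lborel (A b))"
    using A_mono by (auto intro!: mono_onI)
  then have "(\<lambda>b. - measure lborel (A b)) \<in> borel_measurable (restrict_space borel {0<..<1})"
    by (rule borel_measurable_mono_on_fnc)
  then have "(\<lambda>b. - (- measure lborel (A b))) \<in> borel_measurable (restrict_space borel {0<..<1})"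
    by (rule borel_measurable_uminus)
  then have h: "(\<lambda>b. indicator {0<..<1} b *\<^sub>R measure lborel (A b)) \<in> borel_measurable borel"
    by (subst (asm) borel_measurable_restrict_space_iff) auto
  define H where "H b = indicator {0<..<1} b *\<^sub>R measure lborel (A b)" for b
  have snd_meas [measurable]: "(\<lambda>x::real \<times> real. snd x) \<in> borel_measurable borel"
    by (intro borel_measurable_continuous_onI continuous_intros)
  have H_meas [measurable]: "(\<lambda>x::real \<times> real. H (snd x)) \<in> borel_measurable borel"
    using measurable_compose[OF snd_meas h] by (simp add: H_def)
  have rearr_H: "rearr r x = H (snd x) - c" if "x \<in> cell" for x
    using that by (auto simp: rearr H_def cell_def)
  have "integrable lborel (\<lambda>x. indicator cell x *\<^sub>R ((H (snd x) - c) * snd x))"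
  proof (rule Bochner_Integration.integrable_bound)
    show "integrable lborel (\<lambda>x. indicator cell x *\<^sub>R (B + \<bar>c\<bar>))"
      using set_integrable_cell[of "\<lambda>_. B + \<bar>c\<bar>"] by (simp add: set_integrable_def)
    show "(\<lambda>x. indicator cell x *\<^sub>R ((H (snd x) - c) * snd x)) \<in> borel_measurable lborel"
      by measurable
    show "AE x in lborel. norm (indicator cell x *\<^sub>R ((H (snd x) - c) * snd x))
        \<le> norm (indicator cell x *\<^sub>R (B + \<bar>c\<bar>))"
    proof (rule AE_I2)
      fix x :: "real \<times> real"
      show "norm (indicator cell x *\<^sub>R ((H (snd x) - c) * snd x)) \<le> norm (indicator cell x *\<^sub>R (B + \<bar>c\<bar>))"
      proof (cases "x \<in> cell")
        case True
        then have x: "0 < snd x" "snd x < 1" by (auto simp: cell_def)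
        then have "0 \<le> H (snd x)" "H (snd x) \<le> B"
          using A_le[OF x(1)] by (auto simp: H_def)
        then have "\<bar>H (snd x) - c\<bar> * \<bar>snd x\<bar> \<le> (B + \<bar>c\<bar>) * 1"
          using x by (intro mult_mono) auto
        then show ?thesis using True B by (simp add: abs_mult)
      qed simp
    qed
  qed
  moreover have "(\<lambda>x. indicator cell x *\<^sub>R ((H (snd x) - c) * snd x))
      = (\<lambda>x. indicator cell x *\<^sub>R (rearr r x * snd x))"
    by (rule ext) (simp add: rearr_H indicator_def)
  ultimately show ?thesis by (simp add: set_integrable_def)
qed

lemma potential_energy_eq:
  assumes "continuous_on Omega_bar \<rho>\<^sub>0" and r: "continuous_on Omega_bar r"
  shows "potential_energy \<rho>\<^sub>0 r = cell_int (\<lambda>x. r x * snd x) - (LINT x:cell|lborel. rearr \<rho>\<^sub>0 x * snd x)"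
proof -
  have c: "continuous_on Omega_bar (\<lambda>x. r x * snd x)" by (intro continuous_intros r)
  show ?thesis
    unfolding potential_energy_def left_diff_distrib
    using set_integral_diff(2)[OF set_integrable_cell[OF c] set_integrable_rearr[OF assms(1)]]
    by (simp add: set_integral_cell[OF c])
qed

section \<open>Energy balances of the Boussinesq system\<close>

context
  fixes \<rho>\<^sub>0 u\<^sub>0 \<rho> u
  assumes sol: "boussinesq_solution \<rho>\<^sub>0 u\<^sub>0 \<rho> u"
begin

lemma density_C1_time: "C1_time \<rho>" and velocity_C1_time: "C1_time u"
  using sol by (auto simp: boussinesq_solution_def)

lemma density_C1: "t \<ge> 0 \<Longrightarrow> C1_bar (\<rho> t)"
  using sol by (auto simp: boussinesq_solution_def C1_space_def)

lemma velocity_C2: "t \<ge> 0 \<Longrightarrow> C2_bar (u t)"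
  using sol by (auto simp: boussinesq_solution_def C1_space_def C2_space_def C2_bar_def)

lemma velocity_C1: "t \<ge> 0 \<Longrightarrow> C1_bar (u t)"
  using velocity_C2 by (auto simp: C2_bar_def)

lemma velocity_solenoidal: "t \<ge> 0 \<Longrightarrow> solenoidal (u t)"
  using sol by (intro solenoidalI velocity_C1) (auto simp: boussinesq_solution_def)

lemma density_transport:
  assumes t: "t \<ge> 0" and x: "x \<in> Omega_bar"
  shows "Dt \<rho> t x + advect (u t) (\<rho> t) x = 0"
proof (rule eq_on_Omega_bar[OF _ _ _ x])
  show "continuous_on Omega_bar (\<lambda>x. Dt \<rho> t x + advect (u t) (\<rho> t) x)"
    by (intro continuous_intros continuous_advect C1_time_continuous density_C1_time
      velocity_C1_time density_C1 t)
qed (use sol t in \<open>auto simp: boussinesq_solution_def\<close>)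

text \<open>
  Testing with a solenoidal field removes the pressure, and the viscous term is integrated by parts.
\<close>

lemma momentum_weak:
  assumes t: "t \<ge> 0" and \<phi>: "solenoidal \<phi>"
  shows "cell_int (\<lambda>x. \<phi> x \<bullet> Dt u t x) = - cell_int (\<lambda>x. \<phi> x \<bullet> advect (u t) (u t) x)
    - cell_int (\<lambda>x. snd (\<phi> x) * \<rho> t x) - cell_int (\<lambda>x. grad \<phi> x \<bullet> grad (u t) x)"
proof -
  obtain p where p: "C1_bar (p t)" and eq: "\<forall>x\<in>Omega. Dt u t x + advect (u t) (u t) x
      = - grad (p t) x - (0, \<rho> t x) + laplacian (u t) x"
    using sol t unfolding boussinesq_solution_def by blast
  note c = C1_bar_continuous(1)[OF solenoidal_C1[OF \<phi>]] C1_time_continuous(2)[OF velocity_C1_time t]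
    continuous_advect[OF C1_bar_continuous(1)[OF velocity_C1[OF t]] velocity_C1[OF t]]
    continuous_grad[OF p] C1_bar_continuous(1)[OF density_C1[OF t]] continuous_laplacian[OF velocity_C2[OF t]]
  have momentum: "Dt u t x + advect (u t) (u t) x = - grad (p t) x - (0, \<rho> t x) + laplacian (u t) x"
    if "x \<in> Omega_bar" for x
    by (rule eq_on_Omega_bar[OF _ _ _ that]) (use eq in \<open>auto intro!: continuous_intros c\<close>)
  have Dt_eq: "Dt u t x = laplacian (u t) x - grad (p t) x - (0, \<rho> t x) - advect (u t) (u t) x"
    if "x \<in> Omega_bar" for x
    using momentum[OF that] by (simp add: algebra_simps)
  have "cell_int (\<lambda>x. \<phi> x \<bullet> Dt u t x) = cell_int (\<lambda>x. \<phi> x \<bullet> laplacian (u t) x - \<phi> x \<bullet> grad (p t) x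
      - snd (\<phi> x) * \<rho> t x - \<phi> x \<bullet> advect (u t) (u t) x)"
    by (intro cell_int_cong) (simp add: Dt_eq inner_diff_right, simp add: inner_prod_def)
  also have "\<dots> = cell_int (\<lambda>x. \<phi> x \<bullet> laplacian (u t) x) - cell_int (\<lambda>x. \<phi> x \<bullet> grad (p t) x)
      - cell_int (\<lambda>x. snd (\<phi> x) * \<rho> t x) - cell_int (\<lambda>x. \<phi> x \<bullet> advect (u t) (u t) x)"
    by (subst cell_int_diff, (intro continuous_intros c)+)+ simp
  also have "\<dots> = - cell_int (\<lambda>x. \<phi> x \<bullet> advect (u t) (u t) x)
    - cell_int (\<lambda>x. snd (\<phi> x) * \<rho> t x) - cell_int (\<lambda>x. grad \<phi> x \<bullet> grad (u t) x)"
    using green_first[OF solenoidal_C1[OF \<phi>] solenoidal_bdry[OF \<phi>] velocity_C2[OF t]]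
      cell_int_solenoidal_grad[OF \<phi> p] by simp
  finally show ?thesis .
qed

text \<open>
  The derivative of \<open>\<integral>\<rho>\<^sup>4\<close> is \<open>-2 \<integral>(u \<cdot> \<nabla>g) g\<close> with \<open>g = \<rho>\<^sup>2\<close>, and this vanishes by
  skew-symmetry.
\<close>

lemma density_L_norm_4: "t \<ge> 0 \<Longrightarrow> L_norm 4 (\<rho> t) = L_norm 4 \<rho>\<^sub>0"
proof -
  assume t: "t \<ge> 0"
  let ?E = "\<lambda>s. cell_int (\<lambda>x. \<rho> s x ^ 4)"
  note \<rho>' = density_C1_time[unfolded C1_time_def jointly_continuous_iff]
  have "(?E has_real_derivative 0) (at s within {0..})" if s: "s \<in> {0..}" for s
  proof -
    have s0: "s \<ge> 0" using s by simp
    note sq = C1_bar_bilinear[OF bounded_bilinear_inner density_C1[OF s0] density_C1[OF s0]]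
    have "(?E has_real_derivative cell_int (\<lambda>x. 4 * \<rho> s x ^ 3 * Dt \<rho> s x)) (at s within {0..})"
    proof (rule cell_int_has_derivative[OF _ _ _ s0])
      show "((\<lambda>s. \<rho> s x ^ 4) has_real_derivative 4 * \<rho> r x ^ 3 * Dt \<rho> r x) (at r within {0..})"
        if "r \<ge> 0" "x \<in> Omega_bar" for r x
        using DERIV_power[OF C1_time_derivative[OF density_C1_time that, folded has_real_derivative_iff_has_vector_derivative], of 4]
        by (simp add: mult_ac)
      show "jointly_continuous (\<lambda>s x. 4 * \<rho> s x ^ 3 * Dt \<rho> s x)"
        using \<rho>' unfolding jointly_continuous_iff by (intro continuous_intros) auto
    qed (intro continuous_intros C1_time_continuous density_C1_time)
    also have "cell_int (\<lambda>x. 4 * \<rho> s x ^ 3 * Dt \<rho> s x)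
        = cell_int (\<lambda>x. - 2 * (advect (u s) (\<lambda>x. \<rho> s x \<bullet> \<rho> s x) x \<bullet> (\<rho> s x \<bullet> \<rho> s x)))"
    proof (rule cell_int_cong)
      fix x assume x: "x \<in> Omega_bar"
      have "Dt \<rho> s x = - advect (u s) (\<rho> s) x" using density_transport[OF s0 x] by linarith
      then show "4 * \<rho> s x ^ 3 * Dt \<rho> s x
          = - 2 * (advect (u s) (\<lambda>x. \<rho> s x \<bullet> \<rho> s x) x \<bullet> (\<rho> s x \<bullet> \<rho> s x))"
        unfolding advect_inner[OF density_C1[OF s0] density_C1[OF s0] x]
        by (simp add: power3_eq_cube algebra_simps)
    qed
    also have "\<dots> = 0"
      using advect_skew[OF velocity_solenoidal[OF s0] sq sq] by (simp add: mult_ac)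
    finally show ?thesis .
  qed
  then obtain c where "\<forall>s\<in>{0..}. ?E s = c"
    using has_field_derivative_zero_constant[of "{0..}" ?E] by auto
  then have "?E t = ?E 0" using t by simp
  moreover have "(LINT x:cell|lborel. norm (\<rho> s x) powr 4) = ?E s" if "s \<ge> 0" for s
    using set_integral_cell[of "\<lambda>x. \<rho> s x ^ 4"] C1_time_continuous(1)[OF density_C1_time that]
    by (simp add: continuous_intros)
  moreover have "(LINT x:cell|lborel. norm (\<rho> 0 x) powr 4) = (LINT x:cell|lborel. norm (\<rho>\<^sub>0 x) powr 4)"
    using sol cell_subset_closed_cell closed_cell_subset unfolding boussinesq_solution_def
    by (intro set_lebesgue_integral_cong) (auto simp: subset_iff)
  ultimately show ?thesis using t by (simp add: L_norm_def)
qed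

text \<open>
  The potential energy changes at the rate \<open>\<integral>\<rho> u\<^sub>2\<close>, the work done against gravity. The same
  term with the opposite sign appears in the kinetic energy balance, so only dissipation remains.
\<close>

lemma total_energy_derivative:
  assumes t: "t \<ge> 0"
  shows "((\<lambda>s. total_energy \<rho>\<^sub>0 (\<rho> s) (u s)) has_real_derivative - (L_norm 2 (grad (u t)))\<^sup>2) (at t within {0..})"
proof -
  define R where "R = (LINT x:cell|lborel. rearr \<rho>\<^sub>0 x * snd x)"
  have c\<rho>: "continuous_on Omega_bar (\<rho> s)" and cu: "continuous_on Omega_bar (u s)" if "s \<ge> 0" for s
    using that C1_time_continuous(1)[OF density_C1_time] C1_time_continuous(1)[OF velocity_C1_time] by auto
  have "continuous_on Omega_bar \<rho>\<^sub>0"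
    using c\<rho>[of 0] sol by (auto simp: boussinesq_solution_def cong: continuous_on_cong)
  note pot = potential_energy_eq[OF this, folded R_def]
  have csnd: "continuous_on Omega_bar (\<lambda>x. snd x)" by (intro continuous_intros)
  have E: "total_energy \<rho>\<^sub>0 (\<rho> s) (u s)
      = cell_int (\<lambda>x. \<rho> s x \<bullet> snd x) - R + 1 / 2 * cell_int (\<lambda>x. u s x \<bullet> u s x)" if "s \<ge> 0" for s
    using set_integral_cell[of "\<lambda>x. (norm (u s x))\<^sup>2"] cu[OF that]
    by (simp add: total_energy_def pot c\<rho> that kinetic_energy_def continuous_intros power2_norm_eq_inner)
  have "((\<lambda>s. cell_int (\<lambda>x. \<rho> s x \<bullet> snd x)) has_real_derivative cell_int (\<lambda>x. Dt \<rho> t x \<bullet> snd x)) (at t within {0..})"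
    using cell_int_inner_has_derivative[OF density_C1_time C1_time_const(1)[OF csnd] t]
    by (simp add: C1_time_const(2)[OF csnd t])
  moreover have "cell_int (\<lambda>x. Dt \<rho> t x \<bullet> snd x) = cell_int (\<lambda>x. snd (u t x) * \<rho> t x)"
  proof -
    have "cell_int (\<lambda>x. Dt \<rho> t x \<bullet> snd x) = cell_int (\<lambda>x. - (advect (u t) (\<rho> t) x \<bullet> snd x))"
      using density_transport[OF t] by (intro cell_int_cong) (simp add: eq_neg_iff_add_eq_0 flip: distrib_right)
    also have "\<dots> = cell_int (\<lambda>x. \<rho> t x \<bullet> advect (u t) (\<lambda>x. snd x) x)"
      using advect_skew[OF velocity_solenoidal[OF t] density_C1[OF t] C1_bar_snd] by simp
    also have "\<dots> = cell_int (\<lambda>x. snd (u t x) * \<rho> t x)"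
      by (intro cell_int_cong) (simp add: advect_def D1_snd D2_snd)
    finally show ?thesis .
  qed
  moreover have kin: "((\<lambda>s. cell_int (\<lambda>x. u s x \<bullet> u s x)) has_real_derivative 2 * cell_int (\<lambda>x. u t x \<bullet> Dt u t x)) (at t within {0..})"
    using cell_int_inner_has_derivative[OF velocity_C1_time velocity_C1_time t]
    by (simp add: inner_commute flip: mult_2)
  ultimately have "((\<lambda>s. cell_int (\<lambda>x. \<rho> s x \<bullet> snd x) - R + 1 / 2 * cell_int (\<lambda>x. u s x \<bullet> u s x))
      has_real_derivative cell_int (\<lambda>x. snd (u t x) * \<rho> t x) - 0 + 1 / 2 * (2 * cell_int (\<lambda>x. u t x \<bullet> Dt u t x))) (at t within {0..})"
    by (intro DERIV_add DERIV_diff DERIV_const DERIV_cmult) simp_all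
  moreover have "cell_int (\<lambda>x. u t x \<bullet> Dt u t x)
      = - cell_int (\<lambda>x. snd (u t x) * \<rho> t x) - (L_norm 2 (grad (u t)))\<^sup>2"
    unfolding momentum_weak[OF t velocity_solenoidal[OF t]]
    using advect_skew[OF velocity_solenoidal[OF t] velocity_C1[OF t] velocity_C1[OF t]]
    by (simp add: inner_commute L_norm_2 continuous_grad velocity_C1 t power2_norm_eq_inner)
  ultimately have "((\<lambda>s. cell_int (\<lambda>x. \<rho> s x \<bullet> snd x) - R + 1 / 2 * cell_int (\<lambda>x. u s x \<bullet> u s x))
      has_real_derivative - (L_norm 2 (grad (u t)))\<^sup>2) (at t within {0..})"
    by (simp add: add_divide_distrib diff_divide_distrib)
  then show ?thesis
    by (rule has_field_derivative_transform_within[OF _ zero_less_one]) (use t in \<open>simp_all add: E\<close>)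
qed

end

text \<open>
  Testing the momentum equation with \<open>w\<close> and subtracting the Stokes equation for \<open>v\<close> cancels the
  buoyancy and leaves
  \<open>S' = - \<parallel>\<nabla>w\<parallel>\<^sup>2 - \<integral>w \<cdot> (u \<cdot> \<nabla>) u - L\<close>,
  where \<open>L\<close> stands for \<open>\<integral>w \<cdot> v\<^sub>t\<close>. In the convective term \<open>\<integral>w \<cdot> (u \<cdot> \<nabla>) w = 0\<close>, so one factor \<open>u\<close> may be
  replaced by \<open>v\<close>, whose gradient is controlled by \<open>\<rho>\<close>. Each of the two error terms is then at most a multiple
  of \<open>M \<parallel>\<nabla>u\<parallel>\<^sub>2 \<parallel>\<nabla>w\<parallel>\<^sub>2\<close> with \<open>M = \<parallel>\<rho>\<^sub>0\<parallel>\<^sub>4\<close>.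
\<close>

lemma deviation_energy_derivative:
  fixes u v :: "real \<Rightarrow> real \<times> real \<Rightarrow> real \<times> real" and \<rho> :: "real \<Rightarrow> real \<times> real \<Rightarrow> real"
  assumes sol: "boussinesq_solution \<rho>\<^sub>0 u\<^sub>0 \<rho> u"
    and v: "\<And>s. s \<ge> 0 \<Longrightarrow> weak_stokes (\<rho> s) (v s)" and t: "t \<ge> 0"
    and w: "w = (\<lambda>x. u t x - v t x)"
  shows "\<exists>d. ((\<lambda>s. 1 / 2 * (LINT x:cell|lborel. (norm (u s x - v s x))\<^sup>2)) has_real_derivative d) (at t within {0..})
    \<and> d \<le> - (L_norm 2 (grad w))\<^sup>2 + 48 * L_norm 4 \<rho>\<^sub>0 * L_norm 2 (grad (u t)) * L_norm 2 (grad w)"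
proof -
  let ?F = "at t within {0..}"
  define S where "S s = 1 / 2 * (LINT x:cell|lborel. (norm (u s x - v s x))\<^sup>2)" for s :: real
  note us = velocity_solenoidal[OF sol] and u1 = velocity_C1[OF sol] and ut = velocity_C1_time[OF sol]
    and \<rho>1 = density_C1[OF sol] and \<rho>t = density_C1_time[OF sol]
  have vs: "solenoidal (v s)" if "s \<ge> 0" for s using v[OF that] by (simp add: weak_stokes_def)
  note v1 = solenoidal_C1[OF vs]
  have ws: "solenoidal w" unfolding w by (intro solenoidal_diff us vs t)
  note w1 = solenoidal_C1[OF ws]
  note cu = C1_bar_continuous(1)[OF u1] and cv = C1_bar_continuous(1)[OF v1]
    and cw = C1_bar_continuous(1)[OF w1] and c\<rho> = C1_bar_continuous(1)[OF \<rho>1]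
  define Gu where "Gu = L_norm 2 (grad (u t))"
  define Gw where "Gw = L_norm 2 (grad w)"
  define M where "M = L_norm 4 \<rho>\<^sub>0"
  have nn: "0 \<le> Gu" "0 \<le> Gw" "0 \<le> M" by (simp_all add: Gu_def Gw_def M_def L_norm_nonneg)
  have M: "L_norm 4 (\<rho> t) = M" unfolding M_def by (rule density_L_norm_4[OF sol t])
  have u4: "L_norm 4 (u t) \<le> 3 * Gu"
    unfolding Gu_def using L_norm_4_le_grad[OF u1[OF t] solenoidal_bdry[OF us[OF t]]] by blast
  have v4: "L_norm 4 (v t) \<le> 12 * M"
    using L_norm_4_le_grad[OF v1[OF t] solenoidal_bdry[OF vs[OF t]]] stokes_gradient_bound[OF v[OF t]] M
    by linarith
  have w2: "L_norm 2 w \<le> 2 * Gw"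
    unfolding Gw_def using L_norm_2_le_grad[OF w1 solenoidal_bdry[OF ws]] by blast

  obtain L where L: "((\<lambda>s. cell_int (\<lambda>x. w x \<bullet> (v s x - v t x)) / (s - t)) \<longlongrightarrow> L) ?F"
    and L_le: "\<bar>L\<bar> \<le> 2 * L_norm 2 w * (M * L_norm 4 (u t))"
    using stokes_velocity_weakly_differentiable[OF \<rho>t v t us[OF t] \<rho>1[OF t] density_transport[OF sol t] cw]
    unfolding M by blast

  have U: "((\<lambda>s. cell_int (\<lambda>x. w x \<bullet> (u s x - u t x)) / (s - t)) \<longlongrightarrow> cell_int (\<lambda>x. w x \<bullet> Dt u t x)) ?F"
  proof -
    have "((\<lambda>s. cell_int (\<lambda>x. w x \<bullet> u s x)) has_real_derivative cell_int (\<lambda>x. w x \<bullet> Dt u t x)) ?F"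
      using cell_int_inner_has_derivative[OF C1_time_const(1)[OF cw] ut t]
      by (simp add: C1_time_const(2)[OF cw t])
    then have "((\<lambda>s. (cell_int (\<lambda>x. w x \<bullet> u s x) - cell_int (\<lambda>x. w x \<bullet> u t x)) / (s - t))
        \<longlongrightarrow> cell_int (\<lambda>x. w x \<bullet> Dt u t x)) ?F"
      by (simp add: has_field_derivative_iff)
    then show ?thesis
    proof (rule Lim_transform_within[OF _ zero_less_one])
      fix s :: real assume s: "s \<in> {0..}"
      then have s0: "s \<ge> 0" by simp
      show "(cell_int (\<lambda>x. w x \<bullet> u s x) - cell_int (\<lambda>x. w x \<bullet> u t x)) / (s - t)
          = cell_int (\<lambda>x. w x \<bullet> (u s x - u t x)) / (s - t)"
        unfolding inner_diff_right
        by (subst cell_int_diff) (intro continuous_intros cw cu t s0 refl)+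
    qed
  qed

  \<comment> \<open>The quadratic remainder of \<open>S\<close> is negligible: the increments of \<open>u\<close> and of \<open>\<rho>\<close> are of first order in
    \<open>L\<^sup>2\<close>, and the increment of \<open>v\<close> is dominated by that of \<open>\<rho>\<close>.\<close>
  define Q where "Q s = (L_norm 2 (\<lambda>x. (u s x - v s x) - w x))\<^sup>2" for s :: real
  have Q: "((\<lambda>s. Q s / (s - t)) \<longlongrightarrow> 0) ?F"
  proof -
    define P where "P s = 2 * (L_norm 2 (\<lambda>x. u s x - u t x))\<^sup>2 + 32 * (L_norm 2 (\<lambda>x. \<rho> s x - \<rho> t x))\<^sup>2" for s :: real
    have "(P has_real_derivative 2 * 0 + 32 * 0) ?F"
      unfolding P_def[abs_def]
      by (intro DERIV_add DERIV_cmult L_norm_2_increment_has_derivative_0 ut \<rho>t t)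
    moreover have "P t = 0"
      by (simp add: P_def L_norm_def)
    ultimately have "((\<lambda>s. P s / (s - t)) \<longlongrightarrow> 0) ?F"
      by (simp add: has_field_derivative_iff)
    then show ?thesis
    proof (rule Lim_null_comparison[rotated, OF tendsto_rabs_zero])
      have "\<bar>Q s / (s - t)\<bar> \<le> \<bar>P s / (s - t)\<bar>" if s: "s \<in> {0..}" for s
      proof -
        have s0: "s \<ge> 0" using s by simp
        have "L_norm 2 (\<lambda>x. v s x - v t x) \<le> 2 * L_norm 2 (grad (\<lambda>x. v s x - v t x))"
          using L_norm_2_le_grad[OF C1_bar_diff[OF v1[OF s0] v1[OF t]]]
            solenoidal_bdry[OF solenoidal_diff[OF vs[OF s0] vs[OF t]]] by blast
        also have "\<dots> \<le> 2 * (2 * L_norm 2 (\<lambda>x. \<rho> s x - \<rho> t x))"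
          by (intro mult_left_mono weak_stokes_bound_L2 weak_stokes_diff v s0 t) simp
        finally have v_incr: "L_norm 2 (\<lambda>x. v s x - v t x) \<le> 4 * L_norm 2 (\<lambda>x. \<rho> s x - \<rho> t x)" by simp
        have "L_norm 2 (\<lambda>x. (u s x - v s x) - w x) = L_norm 2 (\<lambda>x. (u s x - u t x) - (v s x - v t x))"
          by (simp add: w algebra_simps)
        also have "\<dots> \<le> L_norm 2 (\<lambda>x. u s x - u t x) + L_norm 2 (\<lambda>x. v s x - v t x)"
          by (intro L_norm_2_diff_le continuous_intros cu cv s0 t)
        also have "\<dots> \<le> L_norm 2 (\<lambda>x. u s x - u t x) + 4 * L_norm 2 (\<lambda>x. \<rho> s x - \<rho> t x)"
          using v_incr by simp
        finally have "Q s \<le> (L_norm 2 (\<lambda>x. u s x - u t x) + 4 * L_norm 2 (\<lambda>x. \<rho> s x - \<rho> t x))\<^sup>2"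
          unfolding Q_def by (intro power_mono L_norm_nonneg)
        also have "\<dots> \<le> P s"
          using zero_le_power2[of "L_norm 2 (\<lambda>x. u s x - u t x) - 4 * L_norm 2 (\<lambda>x. \<rho> s x - \<rho> t x)"]
          by (simp add: P_def power2_eq_square algebra_simps)
        finally have "Q s \<le> P s" .
        moreover have "0 \<le> Q s" by (simp add: Q_def)
        ultimately show ?thesis by (simp add: abs_divide divide_right_mono)
      qed
      then show "\<forall>\<^sub>F s in ?F. norm (Q s / (s - t)) \<le> \<bar>P s / (s - t)\<bar>"
        by (auto simp: eventually_at_filter)
    qed
  qed

  have incr: "S s - S t = cell_int (\<lambda>x. w x \<bullet> (u s x - u t x)) - cell_int (\<lambda>x. w x \<bullet> (v s x - v t x)) + Q s / 2"
    if s0: "s \<ge> 0" for s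
  proof -
    have S: "S r = 1 / 2 * cell_int (\<lambda>x. (norm (u r x - v r x))\<^sup>2)" if "r \<ge> 0" for r
      unfolding S_def by (subst set_integral_cell) (intro continuous_intros cu cv that refl)+
    have "S s - S t = 1 / 2 * cell_int (\<lambda>x. (norm (u s x - v s x))\<^sup>2 - (norm (w x))\<^sup>2)"
      unfolding S[OF s0] S[OF t] w
      by (subst cell_int_diff) (auto intro!: continuous_intros cu cv s0 t)
    also have "cell_int (\<lambda>x. (norm (u s x - v s x))\<^sup>2 - (norm (w x))\<^sup>2)
        = cell_int (\<lambda>x. 2 * (w x \<bullet> (u s x - u t x)) - 2 * (w x \<bullet> (v s x - v t x)) + (norm ((u s x - v s x) - w x))\<^sup>2)"
      unfolding w by (intro cell_int_cong) (simp add: power2_norm_eq_inner inner_simps inner_commute algebra_simps)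
    also have "\<dots> = 2 * cell_int (\<lambda>x. w x \<bullet> (u s x - u t x)) - 2 * cell_int (\<lambda>x. w x \<bullet> (v s x - v t x)) + Q s"
      unfolding Q_def
      by (subst L_norm_2 cell_int_add cell_int_diff, (intro continuous_intros cu cv cw s0 t)+)+ simp
    finally show ?thesis by simp
  qed
  define d where "d = cell_int (\<lambda>x. w x \<bullet> Dt u t x) - L + 0 / 2"
  have "((\<lambda>s. cell_int (\<lambda>x. w x \<bullet> (u s x - u t x)) / (s - t)
      - cell_int (\<lambda>x. w x \<bullet> (v s x - v t x)) / (s - t) + Q s / (s - t) / 2) \<longlongrightarrow> d) ?F"
    unfolding d_def by (intro tendsto_intros U L Q) simp
  then have "((\<lambda>s. (S s - S t) / (s - t)) \<longlongrightarrow> d) ?F"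
    by (rule Lim_transform_within[OF _ zero_less_one]) (simp add: incr add_divide_distrib diff_divide_distrib)
  then have deriv: "(S has_real_derivative d) ?F"
    by (simp add: has_field_derivative_iff)

  have conv: "\<bar>cell_int (\<lambda>x. w x \<bullet> advect (u t) (u t) x)\<bar> \<le> 36 * M * Gu * Gw"
  proof -
    have cg: "continuous_on Omega_bar (advect (u t) (v t))" "continuous_on Omega_bar (advect (u t) w)"
      by (intro continuous_advect cu v1 w1 t)+
    have "cell_int (\<lambda>x. w x \<bullet> advect (u t) (u t) x)
        = cell_int (\<lambda>x. advect (u t) (v t) x \<bullet> w x + advect (u t) w x \<bullet> w x)"
      unfolding w by (intro cell_int_cong)
        (simp add: advect_def D1_diff[OF u1[OF t] v1[OF t]] D2_diff[OF u1[OF t] v1[OF t]] inner_simps inner_commute algebra_simps)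
    also have "\<dots> = cell_int (\<lambda>x. advect (u t) (v t) x \<bullet> w x) + cell_int (\<lambda>x. advect (u t) w x \<bullet> w x)"
      by (intro cell_int_add continuous_intros cg cw)
    also have "cell_int (\<lambda>x. advect (u t) w x \<bullet> w x) = 0"
      using advect_skew[OF us[OF t] w1 w1] by (simp add: inner_commute)
    also have "cell_int (\<lambda>x. advect (u t) (v t) x \<bullet> w x) = - cell_int (\<lambda>x. v t x \<bullet> advect (u t) w x)"
      by (rule advect_skew[OF us[OF t] v1[OF t] w1])
    finally have "\<bar>cell_int (\<lambda>x. w x \<bullet> advect (u t) (u t) x)\<bar> \<le> L_norm 4 (v t) * L_norm 4 (u t) * Gw"
      using advect_trilinear_le[OF cu[OF t] cv[OF t] w1] by (simp add: Gw_def)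
    also have "\<dots> \<le> (12 * M) * (3 * Gu) * Gw"
      by (intro mult_mono u4 v4 L_norm_nonneg mult_nonneg_nonneg nn order_refl) (use nn in simp_all)
    finally show ?thesis by simp
  qed
  have L': "\<bar>L\<bar> \<le> 12 * M * Gu * Gw"
  proof -
    have "2 * L_norm 2 w * (M * L_norm 4 (u t)) \<le> 2 * (2 * Gw) * (M * (3 * Gu))"
      by (intro mult_mono u4 w2 L_norm_nonneg mult_nonneg_nonneg nn order_refl) (use nn in \<open>simp_all add: L_norm_nonneg\<close>)
    then show ?thesis using L_le by (simp add: mult_ac)
  qed
  have visc: "cell_int (\<lambda>x. grad w x \<bullet> grad (u t) x) = Gw\<^sup>2 - cell_int (\<lambda>x. snd (w x) * \<rho> t x)"
  proof -
    have "cell_int (\<lambda>x. grad w x \<bullet> grad (u t) x) = cell_int (\<lambda>x. (norm (grad w x))\<^sup>2 + grad w x \<bullet> grad (v t) x)"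
      by (intro cell_int_cong)
         (simp add: w grad_diff[OF u1[OF t] v1[OF t]] power2_norm_eq_inner flip: inner_add_right)
    also have "\<dots> = Gw\<^sup>2 + cell_int (\<lambda>x. grad w x \<bullet> grad (v t) x)"
      unfolding Gw_def L_norm_2[OF continuous_grad[OF w1]]
      by (intro cell_int_add continuous_intros continuous_grad w1 v1 t)
    finally show ?thesis using v[OF t] ws by (simp add: weak_stokes_def)
  qed
  have "d \<le> - Gw\<^sup>2 + 48 * M * Gu * Gw"
    using conv L' unfolding d_def momentum_weak[OF sol t ws] visc by linarith
  with deriv show ?thesis
    unfolding S_def[abs_def] Gu_def Gw_def M_def by blast
qed

text \<open>
  With \<open>a, b, c\<close> the \<open>L\<^sup>2\<close> norms of the gradients of \<open>u, w, v\<close>: Young's inequality spends half of \<open>b\<^sup>2\<close> on the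
  mixed term, which costs \<open>1152 M\<^sup>2 a\<^sup>2\<close>. Since \<open>c\<^sup>2 \<le> 2a\<^sup>2 + 2b\<^sup>2\<close>, the remaining
  \<open>a\<^sup>2 + b\<^sup>2/2\<close> dominates a sixth of \<open>a\<^sup>2 + b\<^sup>2 + c\<^sup>2\<close>.
\<close>

lemma young_absorption:
  fixes M a b c :: real
  assumes "c \<le> a + b" "0 \<le> c"
  shows "(1152 * M\<^sup>2 + 1) * - a\<^sup>2 + (- b\<^sup>2 + 48 * M * a * b) \<le> - (1 / 6) * (a\<^sup>2 + b\<^sup>2 + c\<^sup>2)"
proof -
  have "0 \<le> (48 * M * a - b)\<^sup>2" by simp
  then have 1: "48 * M * a * b \<le> 1152 * M\<^sup>2 * a\<^sup>2 + b\<^sup>2 / 2"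
    by (simp add: power2_eq_square algebra_simps)
  have "c\<^sup>2 \<le> (a + b)\<^sup>2" using assms by (intro power_mono)
  moreover have "0 \<le> (a - b)\<^sup>2" by simp
  ultimately have 2: "c\<^sup>2 \<le> 2 * a\<^sup>2 + 2 * b\<^sup>2" by (simp add: power2_eq_square algebra_simps)
  have eq1: "(1152 * M\<^sup>2 + 1) * - a\<^sup>2 + (- b\<^sup>2 + 48 * M * a * b)
      = (48 * M * a * b - 1152 * M\<^sup>2 * a\<^sup>2) - a\<^sup>2 - b\<^sup>2"
    by (simp add: algebra_simps)
  have eq2: "- (1 / 6) * (a\<^sup>2 + b\<^sup>2 + c\<^sup>2) = - a\<^sup>2 / 6 - b\<^sup>2 / 6 - c\<^sup>2 / 6"
    by (simp add: algebra_simps)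
  show ?thesis unfolding eq1 eq2 using 1 2 zero_le_power2[of a] by linarith
qed

theorem proposition3p2:
  shows "\<exists>C\<^sub>1 C\<^sub>2 :: real \<Rightarrow> real \<Rightarrow> real.
    (\<forall>M E. C\<^sub>1 M E > 0 \<and> C\<^sub>2 M E > 0) \<and>
    (\<forall>(\<rho>\<^sub>0 :: real \<times> real \<Rightarrow> real) (u\<^sub>0 :: real \<times> real \<Rightarrow> real \<times> real)
      (\<rho> :: real \<Rightarrow> real \<times> real \<Rightarrow> real)
      (u :: real \<Rightarrow> real \<times> real \<Rightarrow> real \<times> real)
      (v :: real \<Rightarrow> real \<times> real \<Rightarrow> real \<times> real)
      (w :: real \<Rightarrow> real \<times> real \<Rightarrow> real \<times> real)
      (E\<^sub>T :: real \<Rightarrow> real) (S :: real \<Rightarrow> real) (c\<^sub>1 :: real) (c\<^sub>2 :: real).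
      boussinesq_solution \<rho>\<^sub>0 u\<^sub>0 \<rho> u \<longrightarrow>
      (\<forall>t\<ge>0. stokes_solution (\<rho> t) (v t)) \<longrightarrow>
      w = (\<lambda>t x. u t x - v t x) \<longrightarrow>
      E\<^sub>T = (\<lambda>t. total_energy \<rho>\<^sub>0 (\<rho> t) (u t)) \<longrightarrow>
      S = (\<lambda>t. 1 / 2 * (LINT x:cell|lborel. (norm (w t x))\<^sup>2)) \<longrightarrow>
      c\<^sub>1 = C\<^sub>1 (L_norm 4 \<rho>\<^sub>0) (E\<^sub>T 0) \<longrightarrow>
      c\<^sub>2 = C\<^sub>2 (L_norm 4 \<rho>\<^sub>0) (E\<^sub>T 0) \<longrightarrow>
      (\<forall>t\<ge>0. \<exists>d. ((\<lambda>t. c\<^sub>1 * E\<^sub>T t + S t) has_real_derivative d) (at t within {0..}) \<and>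
        d \<le> - c\<^sub>2 * ((L_norm 2 (grad (u t)))\<^sup>2 + (L_norm 2 (grad (w t)))\<^sup>2
                     + (L_norm 2 (grad (v t)))\<^sup>2)))"
proof (rule exI[of _ "\<lambda>M E. 1152 * M\<^sup>2 + 1"], rule exI[of _ "\<lambda>M E. 1 / 6"], intro conjI allI impI)
  fix \<rho>\<^sub>0 u\<^sub>0 \<rho> u v w E\<^sub>T S and c\<^sub>1 c\<^sub>2 t :: real
  assume sol: "boussinesq_solution \<rho>\<^sub>0 u\<^sub>0 \<rho> u"
    and st: "\<forall>t\<ge>0. stokes_solution (\<rho> t) (v t)"
    and w: "w = (\<lambda>t x. u t x - v t x)"
    and E: "E\<^sub>T = (\<lambda>t. total_energy \<rho>\<^sub>0 (\<rho> t) (u t))"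
    and S: "S = (\<lambda>t. 1 / 2 * (LINT x:cell|lborel. (norm (w t x))\<^sup>2))"
    and c: "c\<^sub>1 = 1152 * (L_norm 4 \<rho>\<^sub>0)\<^sup>2 + 1" "c\<^sub>2 = 1 / 6"
    and t: "0 \<le> t"
  have v: "weak_stokes (\<rho> s) (v s)" if "s \<ge> 0" for s
    using st that by (intro stokes_weak C1_bar_continuous(1) density_C1[OF sol]) auto
  obtain d where d: "(S has_real_derivative d) (at t within {0..})"
    "d \<le> - (L_norm 2 (grad (w t)))\<^sup>2 + 48 * L_norm 4 \<rho>\<^sub>0 * L_norm 2 (grad (u t)) * L_norm 2 (grad (w t))"
    using deviation_energy_derivative[OF sol v t refl] unfolding S w by blast
  have u1: "C1_bar (u t)" and v1: "C1_bar (v t)"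
    using velocity_C1[OF sol t] v[OF t] by (auto simp: weak_stokes_def solenoidal_def)
  have w1: "C1_bar (w t)" unfolding w by (rule C1_bar_diff[OF u1 v1])
  have "L_norm 2 (grad (v t)) \<le> L_norm 2 (\<lambda>x. grad (u t) x - grad (w t) x)"
    by (intro L_norm_2_le continuous_intros continuous_grad u1 v1 w1)
       (use closed_cell_subset in \<open>auto simp: w grad_diff[OF u1 v1]\<close>)
  also have "\<dots> \<le> L_norm 2 (grad (u t)) + L_norm 2 (grad (w t))"
    by (intro L_norm_2_diff_le continuous_grad u1 w1)
  finally have Gv: "L_norm 2 (grad (v t)) \<le> L_norm 2 (grad (u t)) + L_norm 2 (grad (w t))" .
  have "((\<lambda>t. c\<^sub>1 * E\<^sub>T t + S t) has_real_derivative c\<^sub>1 * - (L_norm 2 (grad (u t)))\<^sup>2 + d) (at t within {0..})"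
    unfolding E by (intro DERIV_add DERIV_cmult total_energy_derivative[OF sol t] d(1))
  moreover have "c\<^sub>1 * - (L_norm 2 (grad (u t)))\<^sup>2 + d \<le> - c\<^sub>2 * ((L_norm 2 (grad (u t)))\<^sup>2
      + (L_norm 2 (grad (w t)))\<^sup>2 + (L_norm 2 (grad (v t)))\<^sup>2)"
    using d(2) young_absorption[OF Gv L_norm_nonneg, of "L_norm 4 \<rho>\<^sub>0"] unfolding c by linarith
  ultimately show "\<exists>d. ((\<lambda>t. c\<^sub>1 * E\<^sub>T t + S t) has_real_derivative d) (at t within {0..}) \<and>
        d \<le> - c\<^sub>2 * ((L_norm 2 (grad (u t)))\<^sup>2 + (L_norm 2 (grad (w t)))\<^sup>2
                     + (L_norm 2 (grad (v t)))\<^sup>2)"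
    by blast
qed (auto intro: add_nonneg_pos)

end
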